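(* Let $N\ge1$. The family $\{\Psi_m:m\in\mathfrak W_N\}$ is an orthonormal (Hilbert) basis of $\mathbb L^2(\mathcal C_{2\pi,N},\lambda)$. Moreover, $$\mathcal S_{2\pi,N}:=\left\{\frac{\Psi_m}{\Psi_{\boldsymbol c}}:m\in\mathfrak W_N\right\}$$ is an orthonormal basis of $\mathbb L^2(\mathcal C_{2\pi,N},\boldsymbol\mu)$, consisting of bounded smooth functions on $\overline{\mathcal C}_{2\pi,N}$. Its linear span is dense in $C(\overline{\mathcal C}_{2\pi,N})$ for the uniform topology.
   Context: $\mathcal C_{2\pi,N}=\{\xi\in[0,2\pi)^N:0\le\xi_1<\cdots<\xi_N<2\pi\}$, viewed as the space of $N$-point subsets of $\mathbb R/2\pi\mathbb Z$; its compactification $\overline{\mathcal C}_{2\pi,N}$ is the space of unordered $N$-tuples (multisets) of points of $\mathbb R/2\pi\mathbb Z$, with the quotient topology of $(\mathbb R/2\pi\mathbb Z)^N$ by permutations. Functions on $\overline{\mathcal C}_{2\pi,N}$ are identified with functions on $\mathbb R^N$ that are symmetric and $2\pi$-periodic in each coordinate, and smoothness is understood in this sense. $\lambda$ is $N$-dimensional Lebesgue measure and $C(\cdot)$ denotes complex-valued continuous functions. $\mathfrak W_N=\{m\in\mathbb Z^N:m_1<\cdots<m_N\}$; $\gamma=0$ if $N$ is odd and $\gamma=1/2$ if $N$ is even; for $x\in\mathbb R^N$, $\Psi_m(x)=(2\pi)^{-N/2}\det\big(e^{i(m_k+\gamma)x_l}\big)_{1\le k,l\le N}$; $\boldsymbol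 c=(-p,\dots,p)$ if $N=2p+1$ and $\boldsymbol c=(-p,\dots,p-1)$ if $N=2p$; $$\Psi(x)=\frac{2^{N(N-1)/2}}{(2\pi)^{N/2}}\prod_{1\le i<j\le N}\sin\left(\frac{x_j-x_i}2\right),\qquad\boldsymbol\mu(dx)=\Psi^2(x)\mathbf 1_{\mathcal C_{2\pi,N}}(x)\lambda(dx).$$ $\Psi_{\boldsymbol c}$ equals $\Psi$ up to a constant of modulus one, and quotients $\Psi_m/\Psi_{\boldsymbol c}$ are extended by continuity where $\Psi_{\boldsymbol c}$ vanishes. *)

theory Defs
  imports "HOL-Analysis.Analysis"
begin

text \<open>
  \<open>\<real>\<^sup>N\<close> is \<^typ>\<open>real ^ 'n\<close> for a finite, linearly ordered index type \<open>'n\<close> with \<open>N = CARD('n)\<close>;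
  the order stands for that of the indices \<open>1 < \<dots> < N\<close>.
\<close>

definition config :: "(real ^ 'n::{finite,linorder}) set" where
  "config = {x. (\<forall>i. 0 \<le> x $ i \<and> x $ i < 2 * pi) \<and> (\<forall>i j. i < j \<longrightarrow> x $ i < x $ j)}"

definition weyl_chamber :: "(int ^ 'n::{finite,linorder}) set" where
  "weyl_chamber = {m. \<forall>i j. i < j \<longrightarrow> m $ i < m $ j}"

definition gam :: "nat \<Rightarrow> real" where
  "gam N = (if odd N then 0 else 1 / 2)"

definition Psi_m :: "int ^ 'n::{finite,linorder} \<Rightarrow> real ^ 'n::{finite,linorder} \<Rightarrow> complex" where
  "Psi_m m x = complex_of_real ((2 * pi) powr (- real CARD('n) / 2)) *
     det (\<chi> k l. exp (\<i> * complex_of_real ((real_of_int (m $ k) + gam CARD('n)) * x $ l)))"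

text \<open>
  The summand \<open>card {j. j < k}\<close> is the rank of \<open>k\<close>, running from \<open>0\<close> to \<open>N - 1\<close>. With \<open>p = N div 2\<close>
  this gives \<open>(-p, \<dots>, p)\<close> for \<open>N = 2 * p + 1\<close> and \<open>(-p, \<dots>, p - 1)\<close> for \<open>N = 2 * p\<close>.
\<close>

definition ground :: "int ^ 'n::{finite,linorder}" where
  "ground = (\<chi> k. - int (CARD('n) div 2) + int (card {j. j < k}))"

definition Psi :: "real ^ 'n::{finite,linorder} \<Rightarrow> real" where
  "Psi x = 2 ^ (CARD('n) * (CARD('n) - 1) div 2) / (2 * pi) powr (real CARD('n) / 2) *
     (\<Prod>(i, j) \<in> {(i, j). i < j}. sin ((x $ j - x $ i) / 2))"

definition mu :: "(real ^ 'n::{finite,linorder}) measure" where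
  "mu = density lborel (\<lambda>x. ennreal ((Psi x)\<^sup>2) * indicator config x)"

text \<open>
  Extension by continuity at the zeros of the denominator. \<^const>\<open>Lim\<close> is unspecified where the limit
  does not exist; its existence is part of what the continuity of \<open>S_fun m\<close> expresses, since the
  denominator is nonzero on a dense set.
\<close>

definition S_fun :: "int ^ 'n::{finite,linorder} \<Rightarrow> real ^ 'n::{finite,linorder} \<Rightarrow> complex" where
  "S_fun m x =
     (if Psi_m ground x \<noteq> 0 then Psi_m m x / Psi_m ground x
      else Lim (at x within {y. Psi_m ground y \<noteq> 0}) (\<lambda>y. Psi_m m y / Psi_m ground y))"

definition S_set :: "(real ^ 'n::{finite,linorder} \<Rightarrow> complex) set" where
  "S_set = S_fun ` weyl_chamber"

text \<open>
  Functions on the space of unordered \<open>N\<close>-tuples of points of \<open>\<real> / 2\<pi>\<int>\<close> are represented by their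
  lifts to \<open>\<real>\<^sup>N\<close>; continuity for the quotient topology is continuity of the lift.
\<close>

definition on_cbar :: "(real ^ 'n \<Rightarrow> complex) \<Rightarrow> bool" where
  "on_cbar f \<longleftrightarrow>
     (\<forall>\<sigma> x. bij \<sigma> \<longrightarrow> f (\<chi> i. x $ \<sigma> i) = f x) \<and> (\<forall>i x. f (x + axis i (2 * pi)) = f x)"

definition C_cbar :: "(real ^ 'n \<Rightarrow> complex) set" where
  "C_cbar = {f. on_cbar f \<and> continuous_on UNIV f}"

primrec Ck :: "nat \<Rightarrow> ('a::real_normed_vector \<Rightarrow> 'b::real_normed_vector) \<Rightarrow> bool" where
  "Ck 0 f \<longleftrightarrow> continuous_on UNIV f"
| "Ck (Suc k) f \<longleftrightarrow>
     (\<forall>x. f differentiable (at x)) \<and> (\<forall>v. Ck k (\<lambda>x. frechet_derivative f (at x) v))"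

definition smooth :: "('a::real_normed_vector \<Rightarrow> 'b::real_normed_vector) \<Rightarrow> bool" where
  "smooth f \<longleftrightarrow> (\<forall>k. Ck k f)"

definition lin_span :: "('a \<Rightarrow> complex) set \<Rightarrow> ('a \<Rightarrow> complex) set" where
  "lin_span B = {\<lambda>x. \<Sum>f\<in>F. a f * f x | F a. finite F \<and> F \<subseteq> B}"

text \<open>
  Elements of \<open>L\<^sup>2\<close> are represented by square-integrable functions, not by their classes modulo
  almost everywhere equality.
\<close>

definition L2 :: "'a measure \<Rightarrow> ('a \<Rightarrow> complex) set" where
  "L2 M = {f. f \<in> borel_measurable M \<and> integrable M (\<lambda>x. (norm (f x))\<^sup>2)}"

definition L2_inner :: "'a measure \<Rightarrow> ('a \<Rightarrow> complex) \<Rightarrow> ('a \<Rightarrow> complex) \<Rightarrow> complex" where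
  "L2_inner M f g = (\<integral>x. f x * cnj (g x) \<partial>M)"

definition L2_norm :: "'a measure \<Rightarrow> ('a \<Rightarrow> complex) \<Rightarrow> real" where
  "L2_norm M f = sqrt (\<integral>x. (norm (f x))\<^sup>2 \<partial>M)"

definition orthonormal_basis :: "'a measure \<Rightarrow> 'i set \<Rightarrow> ('i \<Rightarrow> 'a \<Rightarrow> complex) \<Rightarrow> bool" where
  "orthonormal_basis M I \<phi> \<longleftrightarrow>
     (\<forall>m\<in>I. \<phi> m \<in> L2 M) \<and>
     (\<forall>m\<in>I. \<forall>m'\<in>I. L2_inner M (\<phi> m) (\<phi> m') = (if m = m' then 1 else 0)) \<and>
     (\<forall>f\<in>L2 M. \<forall>e>0. \<exists>g\<in>lin_span (\<phi> ` I). L2_norm M (\<lambda>x. f x - g x) < e)"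

end

theory Submission
  imports Defs
begin

text \<open>
  Everything takes place in the algebra of trigonometric polynomials on \<open>\<real>\<^sup>N\<close>, spanned by the plane
  waves \<open>exp (\<i> n \<sqdot> x)\<close> with \<open>n\<close> in \<open>\<int>\<^sup>N\<close>. Up to a symmetric unimodular factor, \<open>Psi_m m\<close> is the
  antisymmetrised plane wave of frequency \<open>m\<close>, and the quotients \<open>S_fun m\<close> are Schur functions in
  \<open>exp (\<i> x\<^sub>k)\<close>.

  The algebraic part is that every alternant is divisible by the ground state, with a symmetric
  trigonometric polynomial as quotient (\<open>Psi_m_divisible\<close>). Multiplying the ground state by a symmetrised
  plane wave gives a sum of alternants (\<open>sym_wave_times_Psi_m\<close>), and by the strict rearrangement
  inequality exactly one of them, with multiplicity, has the longest frequency; so the alternants can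
  be solved for recursively. As the ground state is nonzero on a dense set, this identifies the
  continuous extensions \<open>S_fun m\<close>: they are smooth, bounded, symmetric and periodic, and their span
  is the space of all symmetric trigonometric polynomials. Uniform density then follows from the
  Stone-Weierstrass theorem on the torus by averaging approximants over permutations
  (\<open>span_S_set_uniformly_dense\<close>).

  For the \<open>L2\<close> statements, the permuted copies of \<open>config\<close> tile the box \<open>[0, 2\<pi>]\<^sup>N\<close> up to a null set, so
  that the integral over the box of a function is the integral over \<open>config\<close> of its symmetrisation
  (\<open>integral_period_box_unfold\<close>). This reduces orthonormality of the \<open>Psi_m m\<close> to that of plane waves
  (\<open>Psi_m_orthonormal\<close>) and their completeness to the density of trigonometric polynomials in \<open>L2\<close> of the
  box (\<open>span_Psi_m_L2_dense\<close>). The Vandermonde formula shows that \<open>mu\<close> has density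
  \<open>\<bar>Psi_m ground\<bar>\<^sup>2\<close> (\<open>norm_Psi_m_ground\<close>), so that multiplication by the ground state carries the
  statement for \<open>mu\<close> to the one for Lebesgue measure.
\<close>

section \<open>Permutations of coordinates and rearrangements\<close>

definition permv :: "('n \<Rightarrow> 'n) \<Rightarrow> 'a ^ 'n \<Rightarrow> 'a ^ 'n" where
  "permv p x = (\<chi> i. x $ p i)"

lemma permv_nth [simp]: "permv p x $ i = x $ p i"
  by (simp add: permv_def)

lemma permv_permv: "permv p (permv q x) = permv (q \<circ> p) x"
  by (simp add: vec_eq_iff)

lemma permv_id [simp]: "permv id x = x"
  by (simp add: vec_eq_iff)

lemma permv_inverse:
  assumes "p permutes (UNIV :: 'n::finite set)"
  shows "permv p (permv (inv p) x) = x" "permv (inv p) (permv p x) = x"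
  using permutes_inverses[OF assms] by (simp_all add: vec_eq_iff)

text \<open>
  An inversion of a maximiser could be undone by a transposition, which would increase the sum.
\<close>

lemma maximal_rearrangement_mono:
  fixes r h :: "'n::{finite,linorder} \<Rightarrow> 'a::linordered_idom"
  assumes r: "strict_mono r" and p: "p permutes UNIV"
    and max: "\<And>q. q permutes UNIV \<Longrightarrow> (\<Sum>k\<in>UNIV. r k * h (q k)) \<le> (\<Sum>k\<in>UNIV. r k * h (p k))"
  shows "mono (h \<circ> p)"
proof (rule ccontr)
  assume "\<not> mono (h \<circ> p)"
  then obtain i j where ij: "i \<le> j" "h (p j) < h (p i)"
    by (auto simp: mono_def not_le)
  then have "i < j" by (auto simp: le_less)
  define q where "q = p \<circ> Transposition.transpose i j"
  have q: "q permutes UNIV"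
    unfolding q_def by (intro permutes_compose p permutes_swap_id) auto
  have split: "(\<Sum>k\<in>UNIV. f k) = f i + f j + (\<Sum>k\<in>UNIV - {i, j}. f k)" for f :: "'n \<Rightarrow> 'a"
    using \<open>i < j\<close> by (subst sum.subset_diff[of "{i, j}"]) (auto simp: add.commute)
  have rest: "(\<Sum>k\<in>UNIV - {i, j}. r k * h (q k)) = (\<Sum>k\<in>UNIV - {i, j}. r k * h (p k))"
    by (rule sum.cong) (auto simp: q_def)
  have "(\<Sum>k\<in>UNIV. r k * h (q k)) - (\<Sum>k\<in>UNIV. r k * h (p k)) = (r j - r i) * (h (p i) - h (p j))"
    unfolding split[of "\<lambda>k. r k * h (q k)"] split[of "\<lambda>k. r k * h (p k)"] rest
    by (simp add: q_def algebra_simps)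
  also have "\<dots> > 0"
    using ij \<open>i < j\<close> r by (simp add: strict_mono_def)
  finally show False using max[OF q] by simp
qed

lemma finite_permutations_UNIV [simp]: "finite {p. p permutes (UNIV :: 'n::finite set)}"
  by (rule finite_permutations) simp

lemma maximal_rearrangement_exists:
  fixes F :: "('n::finite \<Rightarrow> 'n) \<Rightarrow> 'a::linorder"
  obtains p where "p permutes UNIV" "\<And>q. q permutes UNIV \<Longrightarrow> F q \<le> F p"
proof -
  let ?S = "F ` {p. p permutes UNIV}"
  have "id permutes (UNIV :: 'n set)" by (rule permutes_id)
  then have "?S \<noteq> {}" by blast
  then have "Max ?S \<in> ?S" by (intro Max_in) auto
  then obtain p where "p permutes UNIV" "Max ?S = F p" by auto
  moreover have "F q \<le> Max ?S" if "q permutes UNIV" for q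
    using that by (intro Max_ge) auto
  ultimately show ?thesis using that by simp
qed

text \<open>
  For every \<open>t\<close> the sublevel sets of \<open>h\<close> and of \<open>h \<circ>
  p\<close> are down-sets of the same cardinality in a finite linear order, and these coincide.
\<close>

lemma mono_rearrangement_unique:
  fixes h :: "'n::{finite,linorder} \<Rightarrow> 'a::linorder"
  assumes p: "p permutes UNIV" and h: "mono h" "mono (h \<circ> p)"
  shows "h \<circ> p = h"
proof -
  have eq: "{k. h (p k) \<le> t} = {k. h k \<le> t}" for t
  proof -
    have "p ` {k. h (p k) \<le> t} = {k. h k \<le> t}"
      using permutes_surj[OF p] by auto
    then have card: "card {k. h (p k) \<le> t} = card {k. h k \<le> t}"
      by (metis card_image permutes_inj[OF p] inj_on_subset subset_UNIV)
    have "{k. h (p k) \<le> t} \<subseteq> {k. h k \<le> t} \<or> {k. h k \<le> t} \<subseteq> {k. h (p k) \<le> t}"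
    proof (rule ccontr)
      assume "\<not> ?thesis"
      then obtain a b where ab: "h (p a) \<le> t" "\<not> h a \<le> t" "h b \<le> t" "\<not> h (p b) \<le> t" by auto
      show False
      proof (cases "a \<le> b")
        case True
        then show False using ab h(1) by (metis monoD order_trans)
      next
        case False
        then have "(h \<circ> p) b \<le> (h \<circ> p) a" using h(2) by (metis linear monoD)
        then show False using ab by auto
      qed
    qed
    then show ?thesis using card by (metis card_subset_eq finite)
  qed
  show ?thesis
  proof
    fix k
    have "k \<in> {j. h (p j) \<le> h k}" "k \<in> {j. h j \<le> h (p k)}"
      using eq[of "h k"] eq[of "h (p k)"] by auto
    then show "(h \<circ> p) k = h k" by auto
  qed
qed

definition rank :: "'n::{finite,linorder} \<Rightarrow> nat" where
  "rank k = card {j. j < k}"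

lemma strict_mono_rank: "strict_mono rank"
  unfolding strict_mono_def rank_def by (auto intro!: psubset_card_mono)

lemma ground_nth: "ground $ k = - int (CARD('n) div 2) + int (rank (k :: 'n::{finite,linorder}))"
  by (simp add: ground_def rank_def)

lemma strict_mono_ground: "strict_mono (\<lambda>k :: 'n::{finite,linorder}. ground $ k)"
  using strict_mono_rank unfolding ground_nth strict_mono_def by simp

text \<open>
  Sorting is maximising the pairing with the ranks.
\<close>

lemma sorting_permutation:
  fixes h :: "'n::{finite,linorder} \<Rightarrow> 'a::linordered_idom"
  obtains p where "p permutes UNIV" "mono (h \<circ> p)"
proof -
  obtain p where p: "p permutes (UNIV :: 'n set)"
    "\<And>q. q permutes UNIV \<Longrightarrow>
       (\<Sum>k\<in>UNIV. of_nat (rank k) * h (q k)) \<le> (\<Sum>k\<in>UNIV. of_nat (rank k) * h (p k))"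
    by (rule maximal_rearrangement_exists[of "\<lambda>p. \<Sum>k\<in>UNIV. of_nat (rank k) * h (p k)"]) blast
  have "strict_mono (\<lambda>k :: 'n. of_nat (rank k) :: 'a)"
    using strict_mono_rank by (simp add: strict_mono_def)
  from maximal_rearrangement_mono[OF this p] show ?thesis using that p(1) by blast
qed

text \<open>
  The strict rearrangement inequality: any maximiser is sorted, and the sorted arrangement is
  unique. It makes the induction in \<open>Psi_m_divisible\<close> descend.
\<close>

lemma rearrangement_strict:
  fixes r h :: "'n::{finite,linorder} \<Rightarrow> 'a::linordered_idom"
  assumes r: "strict_mono r" and h: "mono h" and q: "q permutes UNIV" and ne: "h \<circ> q \<noteq> h"
  shows "(\<Sum>k\<in>UNIV. r k * h (q k)) < (\<Sum>k\<in>UNIV. r k * h k)"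
proof -
  let ?F = "\<lambda>p. \<Sum>k\<in>UNIV. r k * h (p k)"
  obtain p where p: "p permutes (UNIV :: 'n set)" "\<And>q. q permutes UNIV \<Longrightarrow> ?F q \<le> ?F p"
    by (rule maximal_rearrangement_exists[of ?F]) blast
  have "h \<circ> p = h"
    using mono_rearrangement_unique[OF p(1) h] maximal_rearrangement_mono[OF r p] by blast
  then have Fp: "?F p = (\<Sum>k\<in>UNIV. r k * h k)" by (metis comp_apply)
  have "?F q \<noteq> ?F p"
  proof
    assume eq: "?F q = ?F p"
    have "mono (h \<circ> q)"
      using p(2) by (intro maximal_rearrangement_mono[OF r q]) (simp add: eq)
    then show False using mono_rearrangement_unique[OF q h] ne by blast
  qed
  then show ?thesis using p(2)[OF q] Fp by simp
qed

section \<open>Exponentials and alternating sums\<close>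

definition wave :: "int ^ 'n \<Rightarrow> real ^ 'n \<Rightarrow> complex" where
  "wave n x = exp (\<i> * complex_of_real (\<Sum>k\<in>UNIV. real_of_int (n $ k) * x $ k))"

text \<open>
  The half-integer shift \<open>gam\<close> contributes the same factor to all terms of the
  determinant. The factor is symmetric, so that everything else can be done with integer
  frequencies.
\<close>

definition twist :: "real ^ 'n \<Rightarrow> complex" where
  "twist x = exp (\<i> * complex_of_real (gam CARD('n) * (\<Sum>k\<in>UNIV. x $ k)))"

text \<open>
  The normalising constant of \<open>Psi_m\<close>; the type argument carries the dimension.
\<close>

definition amp :: "'n itself \<Rightarrow> complex" where
  "amp _ = complex_of_real ((2 * pi) powr (- real CARD('n) / 2))"

lemma wave_add: "wave (m + n) x = wave m x * wave n x"
  by (simp add: wave_def exp_add[symmetric] sum.distrib algebra_simps)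

lemma wave_zero [simp]: "wave 0 x = 1"
  by (simp add: wave_def)

lemma norm_wave [simp]: "norm (wave n x) = 1"
  by (simp add: wave_def norm_exp_eq_Re)

lemma cnj_wave: "cnj (wave n x) = wave (- n) x"
  by (simp add: wave_def exp_cnj sum_negf)

lemma sum_permv:
  assumes "p permutes (UNIV :: 'n::finite set)"
  shows "(\<Sum>k\<in>UNIV. f (p k)) = (\<Sum>k\<in>(UNIV :: 'n set). f k)"
  using sum.permute[OF assms, of f] by (simp add: o_def)

lemma wave_permv:
  fixes x :: "real ^ 'n"
  assumes p: "p permutes UNIV"
  shows "wave (permv p n) (permv p x) = wave n x"
  using sum_permv[OF p, of "\<lambda>k. real_of_int (n $ k) * x $ k"] by (simp add: wave_def)

lemma twist_permv:
  fixes x :: "real ^ 'n"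
  assumes p: "p permutes UNIV"
  shows "twist (permv p x) = twist x"
  using sum_permv[OF p, of "\<lambda>k. x $ k"] by (simp add: twist_def)

lemma norm_twist [simp]: "norm (twist x) = 1"
  by (simp add: twist_def norm_exp_eq_Re)

text \<open>
  The Leibniz formula: up to \<open>twist\<close>, \<open>Psi_m m\<close> is the
  antisymmetrisation of the plane wave of frequency \<open>m\<close>.
\<close>

lemma Psi_m_eq:
  fixes x :: "real ^ 'n::{finite,linorder}"
  shows "Psi_m m x = amp TYPE('n) * twist x *
     (\<Sum>p | p permutes UNIV. of_int (sign p) * wave m (permv p x))"
proof -
  have "(\<Prod>k\<in>UNIV. exp (\<i> * complex_of_real ((real_of_int (m $ k) + gam CARD('n)) * x $ p k)))
      = twist x * wave m (permv p x)" if p: "p permutes UNIV" for p :: "'n \<Rightarrow> 'n"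
  proof -
    have "(\<Sum>k\<in>UNIV. (real_of_int (m $ k) + gam CARD('n)) * x $ p k)
        = gam CARD('n) * (\<Sum>k\<in>UNIV. x $ k) + (\<Sum>k\<in>UNIV. real_of_int (m $ k) * permv p x $ k)"
      using sum_permv[OF p, of "\<lambda>k. x $ k"]
      by (simp add: sum.distrib sum_distrib_left algebra_simps flip: sum_distrib_left)
    then show ?thesis
      unfolding wave_def twist_def exp_add[symmetric] exp_sum[OF finite, symmetric]
        sum_distrib_left[symmetric] of_real_sum[symmetric] distrib_left[symmetric] of_real_add[symmetric]
      by simp
  qed
  then have "det (\<chi> k l. exp (\<i> * complex_of_real ((real_of_int (m $ k) + gam CARD('n)) * x $ l)))
      = (\<Sum>p | p permutes UNIV. of_int (sign p) * (twist x * wave m (permv p x)))"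
    unfolding det_def by (intro sum.cong refl) (simp only: vec_lambda_beta mem_Collect_eq)
  then show ?thesis
    unfolding Psi_m_def amp_def by (simp add: sum_distrib_left mult_ac)
qed

lemma Psi_m_repeated:
  fixes x :: "real ^ 'n::{finite,linorder}"
  assumes "\<not> inj (\<lambda>k. m $ k)"
  shows "Psi_m m x = 0"
proof -
  obtain i j where ij: "m $ i = m $ j" "i \<noteq> j"
    using assms by (auto simp: inj_def)
  then show ?thesis
    unfolding Psi_m_def by (subst det_identical_rows[of i j]) (auto simp: row_def)
qed

lemma Psi_m_permv_left:
  fixes x :: "real ^ 'n::{finite,linorder}"
  assumes "p permutes UNIV"
  shows "Psi_m (permv p m) x = of_int (sign p) * Psi_m m x"
  unfolding Psi_m_def using det_permute_rows[OF assms,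
    of "\<chi> k l. exp (\<i> * complex_of_real ((real_of_int (m $ k) + gam CARD('n)) * x $ l))"]
  by simp

lemma Psi_m_permv_right:
  fixes x :: "real ^ 'n::{finite,linorder}"
  assumes "p permutes UNIV"
  shows "Psi_m m (permv p x) = of_int (sign p) * Psi_m m x"
  unfolding Psi_m_def using det_permute_columns[OF assms,
    of "\<chi> k l. exp (\<i> * complex_of_real ((real_of_int (m $ k) + gam CARD('n)) * x $ l))"]
  by simp

text \<open>
  A multiple of the monomial symmetric function with exponent \<open>n\<close> in the variables
  \<open>exp (\<i> x\<^sub>k)\<close>, negative exponents included.
\<close>

definition sym_wave :: "int ^ 'n::finite \<Rightarrow> real ^ 'n \<Rightarrow> complex" where
  "sym_wave n x = (\<Sum>p | p permutes UNIV. wave n (permv p x))"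

lemma sum_permutations_compose_left:
  assumes "q permutes (UNIV :: 'n::finite set)"
  shows "(\<Sum>p | p permutes (UNIV :: 'n set). f (q \<circ> p)) = (\<Sum>p | p permutes UNIV. f p)"
  by (rule setum_permutations_compose_left[OF assms, symmetric])

lemma sum_permutations_inv:
  "(\<Sum>p | p permutes (UNIV :: 'n::finite set). f (inv p)) = (\<Sum>p | p permutes UNIV. f p)"
  by (rule sum_permutations_inverse[symmetric])

text \<open>
  In the double sum over \<open>q\<close> (from \<open>sym_wave\<close>) and \<open>p\<close>
  (from the determinant) substitute \<open>q = p \<circ> r\<close>: for fixed \<open>r\<close>
  both exponentials depend on \<open>permv p x\<close> only, and the sum over \<open>p\<close> is
  again a determinant.
\<close>

lemma sym_wave_times_Psi_m:
  fixes x :: "real ^ 'n::{finite,linorder}"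
  shows "sym_wave n x * Psi_m c x = (\<Sum>r | r permutes UNIV. Psi_m (c + permv r n) x)"
proof -
  let ?S = "{p. p permutes (UNIV :: 'n set)}"
  let ?A = "amp TYPE('n) * twist x"
  have "sym_wave n x * Psi_m c x
     = ?A * (\<Sum>p\<in>?S. of_int (sign p) * wave c (permv p x) * sym_wave n x)"
    by (simp add: Psi_m_eq sum_distrib_left mult_ac)
  also have "(\<Sum>p\<in>?S. of_int (sign p) * wave c (permv p x) * sym_wave n x)
     = (\<Sum>p\<in>?S. of_int (sign p) * wave c (permv p x) * (\<Sum>r\<in>?S. wave (permv r n) (permv p x)))"
  proof (rule sum.cong[OF refl])
    fix p assume "p \<in> ?S"
    then have p: "p permutes UNIV" by simp
    have "sym_wave n x = (\<Sum>r\<in>?S. wave n (permv (p \<circ> r) x))"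
      unfolding sym_wave_def using p by (rule sum_permutations_compose_left[symmetric])
    also have "\<dots> = (\<Sum>r\<in>?S. wave (permv (inv r) n) (permv p x))"
    proof (rule sum.cong[OF refl])
      fix r assume "r \<in> ?S"
      then have r: "r permutes UNIV" by simp
      have "wave n (permv (p \<circ> r) x) = wave (permv r (permv (inv r) n)) (permv r (permv p x))"
        by (simp add: permv_permv[symmetric] permv_inverse[OF r])
      then show "wave n (permv (p \<circ> r) x) = wave (permv (inv r) n) (permv p x)"
        by (simp add: wave_permv[OF r])
    qed
    also have "\<dots> = (\<Sum>r\<in>?S. wave (permv r n) (permv p x))"
      by (rule sum_permutations_inv)
    finally show "of_int (sign p) * wave c (permv p x) * sym_wave n x =
      of_int (sign p) * wave c (permv p x) * (\<Sum>r\<in>?S. wave (permv r n) (permv p x))" by simp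
  qed
  also have "\<dots> = (\<Sum>r\<in>?S. \<Sum>p\<in>?S. of_int (sign p) * wave (c + permv r n) (permv p x))"
    by (subst sum.swap) (simp add: sum_distrib_left wave_add mult_ac)
  finally show ?thesis by (simp add: Psi_m_eq sum_distrib_left)
qed

section \<open>Linear spans of functions\<close>

lemma lin_span_base: "f \<in> B \<Longrightarrow> f \<in> lin_span B"
  unfolding lin_span_def by (intro CollectI exI[of _ "{f}"] exI[of _ "\<lambda>_. 1"]) auto

lemma lin_span_zero: "(\<lambda>_. 0) \<in> lin_span B"
  unfolding lin_span_def by (intro CollectI exI[of _ "{}"]) auto

lemma lin_span_cmult:
  assumes "f \<in> lin_span B" shows "(\<lambda>x. c * f x) \<in> lin_span B"
proof -
  obtain F a where F: "f = (\<lambda>x. \<Sum>g\<in>F. a g * g x)" "finite F" "F \<subseteq> B"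
    using assms unfolding lin_span_def by blast
  then show ?thesis unfolding lin_span_def
    by (intro CollectI exI[of _ F] exI[of _ "\<lambda>g. c * a g"]) (auto simp: sum_distrib_left mult_ac)
qed

lemma lin_span_add:
  assumes "f \<in> lin_span B" "g \<in> lin_span B" shows "(\<lambda>x. f x + g x) \<in> lin_span B"
proof -
  obtain F a where F: "f = (\<lambda>x. \<Sum>h\<in>F. a h * h x)" "finite F" "F \<subseteq> B"
    using assms unfolding lin_span_def by blast
  obtain G b where G: "g = (\<lambda>x. \<Sum>h\<in>G. b h * h x)" "finite G" "G \<subseteq> B"
    using assms unfolding lin_span_def by blast
  let ?c = "\<lambda>h. (if h \<in> F then a h else 0) + (if h \<in> G then b h else 0)"
  have "f x + g x = (\<Sum>h\<in>F \<union> G. ?c h * h x)" for x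
  proof -
    have "f x = (\<Sum>h\<in>F \<union> G. (if h \<in> F then a h else 0) * h x)"
      unfolding F(1) using F G by (intro sum.mono_neutral_cong_left) auto
    moreover have "g x = (\<Sum>h\<in>F \<union> G. (if h \<in> G then b h else 0) * h x)"
      unfolding G(1) using F G by (intro sum.mono_neutral_cong_left) auto
    ultimately show ?thesis by (simp add: sum.distrib distrib_right)
  qed
  then show ?thesis unfolding lin_span_def
    using F G by (intro CollectI exI[of _ "F \<union> G"] exI[of _ ?c]) auto
qed

lemma lin_span_sum:
  assumes "\<And>i. i \<in> I \<Longrightarrow> f i \<in> lin_span B" shows "(\<lambda>x. \<Sum>i\<in>I. f i x) \<in> lin_span B"
  using assms
  by (induction I rule: infinite_finite_induct) (auto intro: lin_span_zero lin_span_add)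

text \<open>
  Properties of spans are proved below by adding one generator at a time.
\<close>

lemma lin_span_induct [consumes 1, case_names zero step]:
  assumes "f \<in> lin_span B" and "P (\<lambda>_. 0)"
    and step: "\<And>b c g. b \<in> B \<Longrightarrow> g \<in> lin_span B \<Longrightarrow> P g \<Longrightarrow> P (\<lambda>x. c * b x + g x)"
  shows "P f"
proof -
  obtain F a where F: "f = (\<lambda>x. \<Sum>h\<in>F. a h * h x)" "finite F" "F \<subseteq> B"
    using assms unfolding lin_span_def by blast
  from F(2,3) have "P (\<lambda>x. \<Sum>h\<in>F. a h * h x)"
  proof (induction F)
    case empty
    then show ?case using assms by simp
  next
    case (insert h F)
    have "(\<lambda>x. \<Sum>h\<in>F. a h * h x) \<in> lin_span B"
      using insert unfolding lin_span_def by blast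
    from step[OF _ this, of h "a h"] insert show ?case by simp
  qed
  then show ?thesis using F by simp
qed

lemma lin_span_mult:
  assumes B: "\<And>f g. f \<in> B \<Longrightarrow> g \<in> B \<Longrightarrow> (\<lambda>x. f x * g x) \<in> lin_span B"
    and f: "f \<in> lin_span B" and g: "g \<in> lin_span B"
  shows "(\<lambda>x. f x * g x) \<in> lin_span B"
  using f
proof (induction rule: lin_span_induct)
  case zero
  then show ?case using lin_span_zero by simp
next
  case (step b c h)
  have "(\<lambda>x. b x * g x) \<in> lin_span B"
    using g
  proof (induction rule: lin_span_induct)
    case zero
    then show ?case using lin_span_zero by simp
  next
    case (step b' c' h')
    then show ?case
      using lin_span_add[OF lin_span_cmult[OF B[OF \<open>b \<in> B\<close> \<open>b' \<in> B\<close>], of c'] step(3)]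
      by (simp add: algebra_simps)
  qed
  from lin_span_add[OF lin_span_cmult[OF this, of c] step(3)] show ?case
    by (simp add: algebra_simps)
qed

lemma lin_span_subset:
  assumes "B \<subseteq> lin_span C" "f \<in> lin_span B" shows "f \<in> lin_span C"
  using assms(2)
  by (induction rule: lin_span_induct)
     (use assms(1) in \<open>auto intro!: lin_span_zero lin_span_add lin_span_cmult\<close>)

section \<open>Divisibility by the ground state\<close>

text \<open>
  Only the mixed term of the square depends on the arrangement of \<open>n\<close>, and
  \<open>ground\<close> is strictly increasing, so the sorted arrangement is the unique maximiser.
\<close>

lemma sum_squares_ground_plus_less:
  fixes n :: "int ^ 'n::{finite,linorder}"
  assumes n: "mono (\<lambda>k. n $ k)" and r: "r permutes UNIV" and ne: "permv r n \<noteq> n"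
  shows "(\<Sum>k\<in>UNIV. ((ground + permv r n) $ k)\<^sup>2) < (\<Sum>k\<in>UNIV. ((ground + n) $ k)\<^sup>2)"
proof -
  have "(\<Sum>k\<in>UNIV. ground $ k * n $ r k) < (\<Sum>k\<in>UNIV. ground $ k * n $ k)"
    using rearrangement_strict[OF strict_mono_ground n r] ne by (auto simp: vec_eq_iff fun_eq_iff)
  moreover have "(\<Sum>k\<in>UNIV. (n $ r k)\<^sup>2) = (\<Sum>k\<in>UNIV. (n $ k)\<^sup>2)"
    using sum_permv[OF r, of "\<lambda>k. (n $ k)\<^sup>2"] .
  ultimately show ?thesis
    by (simp add: power2_sum sum.distrib mult.assoc flip: sum_distrib_left)
qed

text \<open>
  The entries of \<open>ground\<close> are consecutive integers, so those of \<open>m\<close>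
  increase at least as fast.
\<close>

lemma weyl_chamber_minus_ground_mono:
  fixes m :: "int ^ 'n::{finite,linorder}"
  assumes m: "m \<in> weyl_chamber"
  shows "mono (\<lambda>k. (m - ground) $ k)"
proof (rule monoI)
  fix i j :: 'n assume "i \<le> j"
  have "card {i..<j} \<le> card {m $ i..<m $ j}"
  proof (rule card_inj_on_le)
    show "inj_on (($) m) {i..<j}"
      using m by (auto simp: weyl_chamber_def inj_on_def) (metis less_irrefl linorder_less_linear)
    show "($) m ` {i..<j} \<subseteq> {m $ i..<m $ j}"
      using m by (auto simp: weyl_chamber_def le_less)
  qed simp
  moreover have "rank j = rank i + card {i..<j}"
  proof -
    have "{k. k < j} = {k. k < i} \<union> {i..<j}" using \<open>i \<le> j\<close> by auto
    moreover have "{k. k < i} \<inter> {i..<j} = {}" by auto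
    ultimately show ?thesis unfolding rank_def by (simp add: card_Un_disjoint)
  qed
  moreover have "m $ i \<le> m $ j"
    using m \<open>i \<le> j\<close> by (auto simp: weyl_chamber_def le_less)
  ultimately show "(m - ground) $ i \<le> (m - ground) $ j"
    by (simp add: ground_nth)
qed

lemma sort_into_weyl_chamber:
  fixes m :: "int ^ 'n::{finite,linorder}"
  assumes "inj (\<lambda>k. m $ k)"
  obtains p where "p permutes UNIV" "permv p m \<in> weyl_chamber"
proof -
  obtain p where p: "p permutes (UNIV :: 'n set)" "mono ((\<lambda>k. m $ k) \<circ> p)"
    by (rule sorting_permutation)
  have "permv p m \<in> weyl_chamber"
    unfolding weyl_chamber_def
  proof (clarsimp)
    fix i j :: 'n assume "i < j"
    moreover from this have "m $ p i \<noteq> m $ p j"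
      using assms permutes_inj[OF p(1)] by (metis injD less_irrefl)
    ultimately show "m $ p i < m $ p j"
      using p(2) by (metis comp_apply less_imp_le monoD order_le_less)
  qed
  then show ?thesis using that p by blast
qed

text \<open>
  Induction on the Euclidean length of \<open>m\<close>. After sorting, write \<open>m = ground +
  n\<close> with \<open>n\<close> increasing. The product \<open>sym_wave n * Psi_m ground\<close>
  is the sum of the \<open>Psi_m (ground + permv r n)\<close>. The permutations \<open>r\<close>
  that fix \<open>n\<close> each contribute \<open>Psi_m m\<close>, and every other term has a
  strictly shorter frequency. Solving for \<open>Psi_m m\<close> gives the quotient. This is the
  unitriangularity of Schur functions against monomial symmetric functions.
\<close>

theorem Psi_m_divisible:
  fixes m :: "int ^ 'n::{finite,linorder}"
  shows "\<exists>P\<in>lin_span (range sym_wave). \<forall>x. Psi_m m x = P x * Psi_m ground x"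
proof (induction "nat (\<Sum>k\<in>UNIV. (m $ k)\<^sup>2)" arbitrary: m rule: less_induct)
  case (less m)
  consider "\<not> inj (\<lambda>k. m $ k)" | "inj (\<lambda>k. m $ k)" by blast
  then show ?case
  proof cases
    case 1
    then show ?thesis by (intro bexI[OF _ lin_span_zero]) (simp add: Psi_m_repeated)
  next
    case 2
    \<comment> \<open>The arrangement of \<open>m\<close> affects neither the induction measure nor, up to sign,
      \<open>Psi_m m\<close>.\<close>
    obtain p where p: "p permutes (UNIV :: 'n set)" "permv p m \<in> weyl_chamber"
      using sort_into_weyl_chamber[OF 2] .
    let ?m = "permv p m"
    define n where "n = ?m - ground"
    have n: "mono (\<lambda>k. n $ k)"
      unfolding n_def by (rule weyl_chamber_minus_ground_mono[OF p(2)])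
    let ?S = "{r. r permutes (UNIV :: 'n set)}"
    let ?fix = "{r \<in> ?S. permv r n = n}"
    let ?mov = "{r \<in> ?S. permv r n \<noteq> n}"
    have "\<exists>P\<in>lin_span (range sym_wave). \<forall>x. Psi_m (ground + permv r n) x = P x * Psi_m ground x"
      if "r \<in> ?mov" for r
    proof (rule less)
      have "(\<Sum>k\<in>UNIV. ((ground + n) $ k)\<^sup>2) = (\<Sum>k\<in>UNIV. (m $ k)\<^sup>2)"
        using sum_permv[OF p(1), of "\<lambda>k. (m $ k)\<^sup>2"] by (simp add: n_def)
      then have "(\<Sum>k\<in>UNIV. ((ground + permv r n) $ k)\<^sup>2) < (\<Sum>k\<in>UNIV. (m $ k)\<^sup>2)"
        using sum_squares_ground_plus_less[OF n, of r] that by simp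
      moreover have "0 \<le> (\<Sum>k\<in>UNIV. ((ground + permv r n) $ k)\<^sup>2)"
        by (rule sum_nonneg) simp
      ultimately show "nat (\<Sum>k\<in>UNIV. ((ground + permv r n) $ k)\<^sup>2) < nat (\<Sum>k\<in>UNIV. (m $ k)\<^sup>2)"
        by linarith
    qed
    then have "\<forall>r\<in>?mov. \<exists>P. P \<in> lin_span (range sym_wave) \<and>
        (\<forall>x. Psi_m (ground + permv r n) x = P x * Psi_m ground x)"
      by (auto simp: Bex_def)
    from bchoice[OF this] obtain P where P:
      "\<And>r. r \<in> ?mov \<Longrightarrow> P r \<in> lin_span (range sym_wave)"
      "\<And>r x. r \<in> ?mov \<Longrightarrow> Psi_m (ground + permv r n) x = P r x * Psi_m ground x"
      by blast
    have fin: "finite ?S" by simp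
    have "id \<in> ?fix" by (simp add: permutes_id)
    then have "?fix \<noteq> {}" by blast
    then have card: "card ?fix \<noteq> 0" using fin by (simp add: card_eq_0_iff)
    \<comment> \<open>The factor \<open>sign p\<close> undoes the sorting of \<open>m\<close>.\<close>
    define Q where "Q x = of_int (sign p) * (1 / of_nat (card ?fix)) * (sym_wave n x + (- 1) * (\<Sum>r\<in>?mov. P r x))" for x
    have "Q \<in> lin_span (range sym_wave)"
      unfolding Q_def[abs_def]
      by (intro lin_span_cmult lin_span_add lin_span_sum P) (auto intro: lin_span_base)
    moreover have "Psi_m m x = Q x * Psi_m ground x" for x
    proof -
      have "sym_wave n x * Psi_m ground x
          = (\<Sum>r\<in>?fix. Psi_m (ground + permv r n) x) + (\<Sum>r\<in>?mov. Psi_m (ground + permv r n) x)"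
      proof -
        have "?mov = ?S - ?fix" by blast
        then show ?thesis
          unfolding sym_wave_times_Psi_m
          using sum.subset_diff[of ?fix ?S "\<lambda>r. Psi_m (ground + permv r n) x"] fin
          by (simp add: add.commute Collect_mono_iff)
      qed
      also have "(\<Sum>r\<in>?fix. Psi_m (ground + permv r n) x) = of_nat (card ?fix) * Psi_m ?m x"
        by (simp add: n_def)
      also have "(\<Sum>r\<in>?mov. Psi_m (ground + permv r n) x) = (\<Sum>r\<in>?mov. P r x) * Psi_m ground x"
        using P(2) by (simp add: sum_distrib_right)
      finally have eq: "of_nat (card ?fix) * Psi_m ?m x = (sym_wave n x + (- 1) * (\<Sum>r\<in>?mov. P r x)) * Psi_m ground x"
        by (simp add: algebra_simps)
      have "Psi_m m x = of_int (sign p) * Psi_m ?m x"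
        using Psi_m_permv_left[OF p(1), of m x] by (simp add: sign_def)
      also have "\<dots> = of_int (sign p) * (1 / of_nat (card ?fix)) * (of_nat (card ?fix) * Psi_m ?m x)"
      proof -
        have cancel: "s * y = s * (1 / c) * (c * y)" if "c \<noteq> 0" for s c y :: complex
          using that by simp
        show ?thesis by (rule cancel) (use card in \<open>simp only: of_nat_eq_0_iff not_False_eq_True\<close>)
      qed
      finally show ?thesis unfolding eq Q_def by simp
    qed
    ultimately show ?thesis by blast
  qed
qed

section \<open>The Vandermonde determinant and the weight\<close>

text \<open>
  A permutation other than the identity moves some index up, where the matrix vanishes.
\<close>

lemma det_lower_triangular:
  fixes A :: "'a::comm_ring_1 ^ 'n::{finite,linorder} ^ 'n::{finite,linorder}"
  assumes A: "\<And>i j. i < j \<Longrightarrow> A $ i $ j = 0"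
  shows "det A = (\<Prod>i\<in>UNIV. A $ i $ i)"
proof -
  have zero: "of_int (sign p) * (\<Prod>i\<in>UNIV. A $ i $ p i) = 0"
    if p: "p permutes UNIV" "p \<noteq> id" for p
  proof -
    have "\<exists>i. i < p i"
    proof (rule ccontr)
      assume "\<not> ?thesis"
      then have le: "rank (p i) \<le> rank i" for i
        using strict_mono_mono[OF strict_mono_rank] by (metis monoD not_less)
      have "rank (p i) = rank i" for i
        using sum_mono_inv[of "\<lambda>i. rank (p i)" UNIV rank i] sum_permv[OF p(1), of rank] le by simp
      then have "p i = i" for i
        using strict_mono_eq[OF strict_mono_rank] by blast
      then show False using p(2) by auto
    qed
    then obtain i where "A $ i $ p i = 0" using A by blast
    then have "(\<Prod>i\<in>UNIV. A $ i $ p i) = 0" by (intro prod_zero) auto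
    then show ?thesis by simp
  qed
  have "det A = (\<Sum>p\<in>{id}. of_int (sign p) * (\<Prod>i\<in>UNIV. A $ i $ p i))"
    unfolding det_def using zero by (intro sum.mono_neutral_right) (auto simp: permutes_id)
  then show ?thesis by (simp add: sign_id)
qed

lemma bij_betw_rank: "bij_betw (rank :: 'n::{finite,linorder} \<Rightarrow> nat) UNIV {..<CARD('n)}"
proof (rule bij_betw_imageI)
  show inj: "inj (rank :: 'n \<Rightarrow> nat)" using strict_mono_rank strict_mono_on_imp_inj_on by blast
  have "rank k < CARD('n)" for k :: 'n
    unfolding rank_def by (rule psubset_card_mono) auto
  then show "range (rank :: 'n \<Rightarrow> nat) = {..<CARD('n)}"
    by (intro card_subset_eq) (auto simp: card_image[OF inj])
qed

text \<open>
  Replacing the monomials \<open>z ^ rank k\<close> by the monic Newton polynomials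
  \<open>\<Prod>j<k. z - z j\<close> is a unitriangular change of rows and leaves the determinant
  alone. The Newton polynomial of index \<open>k\<close> vanishes at \<open>z l\<close> for
  \<open>l < k\<close>, so the new matrix is triangular and the product formula is its diagonal.
\<close>

lemma vandermonde_det:
  fixes z :: "'n::{finite,linorder} \<Rightarrow> 'a::idom"
  shows "det (\<chi> k l. z l ^ rank k :: 'a ^ 'n::{finite,linorder} ^ 'n::{finite,linorder}) = (\<Prod>l\<in>UNIV. \<Prod>j\<in>{..<l}. z l - z j)"
proof -
  define p where "p k = (\<Prod>j\<in>{..<k}. [:- z j, 1:])" for k
  have deg: "degree (p k) = rank k" for k
    unfolding p_def rank_def by (subst degree_prod_eq_sum_degree) (auto simp: lessThan_def)
  have monic: "coeff (p k) (rank k) = 1" for k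
    using lead_coeff_prod[of "\<lambda>j. [:- z j, 1:]" "{..<k}"] by (simp add: deg[symmetric] p_def)
  define L :: "'a ^ 'n::{finite,linorder} ^ 'n::{finite,linorder}" where "L = (\<chi> k j. coeff (p k) (rank j))"
  let ?V = "\<chi> k l. z l ^ rank k :: 'a ^ 'n::{finite,linorder} ^ 'n::{finite,linorder}"
  have "det L = 1"
  proof (subst det_lower_triangular)
    fix i j :: 'n assume "i < j"
    then show "L $ i $ j = 0"
      using strict_monoD[OF strict_mono_rank] by (auto simp: L_def deg intro!: coeff_eq_0)
  qed (simp add: L_def monic)
  have prod: "(L ** ?V) $ k $ l = (\<Prod>j\<in>{..<k}. z l - z j)" for k l
  proof -
    have "(L ** ?V) $ k $ l = (\<Sum>j\<in>(UNIV :: 'n set). coeff (p k) (rank j) * z l ^ rank j)"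
      by (simp add: matrix_matrix_mult_def L_def)
    also have "\<dots> = (\<Sum>d<CARD('n). coeff (p k) d * z l ^ d)"
      using sum.reindex_bij_betw[OF bij_betw_rank, of "\<lambda>d. coeff (p k) d * z l ^ d"] .
    also have "\<dots> = (\<Sum>d\<le>degree (p k). coeff (p k) d * z l ^ d)"
    proof -
      have "degree (p k) < CARD('n)"
        using bij_betw_rank[where 'n = 'n] by (auto simp: deg bij_betw_def)
      then show ?thesis by (intro sum.mono_neutral_right) (auto simp: coeff_eq_0)
    qed
    also have "\<dots> = (\<Prod>j\<in>{..<k}. z l - z j)"
      by (simp add: poly_altdef[symmetric] p_def poly_prod)
    finally show ?thesis .
  qed
  have "det ?V = det (L ** ?V)" by (simp add: det_mul \<open>det L = 1\<close>)
  also have "\<dots> = det (transpose (L ** ?V))" by (simp add: det_transpose)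
  also have "\<dots> = (\<Prod>l\<in>UNIV. transpose (L ** ?V) $ l $ l)"
    by (rule det_lower_triangular) (auto simp: transpose_def prod)
  finally show ?thesis by (simp add: transpose_def prod)
qed

text \<open>
  Converts the product over pairs in the definition of \<open>Psi\<close> into the iterated form
  of the Vandermonde formula.
\<close>

lemma prod_pairs_less:
  fixes f :: "'n::{finite,linorder} \<Rightarrow> 'n \<Rightarrow> 'a::comm_monoid_mult"
  shows "(\<Prod>(i, j)\<in>{(i, j). i < j}. f i j) = (\<Prod>j\<in>UNIV. \<Prod>i\<in>{..<j}. f i j)"
proof -
  have "(\<Prod>j\<in>UNIV. \<Prod>i\<in>{..<j}. f i j) = (\<Prod>(j, i)\<in>(SIGMA j:UNIV. {..<j}). f i j)"
    by (subst prod.Sigma) auto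
  also have "\<dots> = (\<Prod>(i, j)\<in>{(i, j). i < j}. f i j)"
    by (rule prod.reindex_bij_witness[of _ "\<lambda>(i, j). (j, i)" "\<lambda>(j, i). (i, j)"]) auto
  finally show ?thesis ..
qed

lemma norm_exp_ii_diff: "norm (exp (\<i> * of_real b) - exp (\<i> * of_real a)) = \<bar>2 * sin ((b - a) / 2)\<bar>"
proof -
  have "exp (\<i> * of_real b) - exp (\<i> * of_real a)
      = exp (\<i> * of_real ((a + b) / 2)) * (exp (\<i> * of_real ((b - a) / 2)) - exp (- (\<i> * of_real ((b - a) / 2))))"
    by (simp add: right_diff_distrib exp_add[symmetric] field_simps)
  also have "exp (\<i> * of_real ((b - a) / 2)) - exp (- (\<i> * of_real ((b - a) / 2)))
      = 2 * \<i> * of_real (sin ((b - a) / 2))"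
    unfolding sin_of_real[symmetric] by (simp add: sin_exp_eq field_simps)
  finally show ?thesis by (simp add: norm_mult norm_exp_eq_Re)
qed

text \<open>
  The exponents \<open>ground\<close> are the ranks up to a common shift, so the determinant is a
  Vandermonde determinant in \<open>exp (\<i> x\<^sub>l)\<close> up to a unimodular factor; the
  chord length between two points of the unit circle is \<open>2 * \<bar>sin\<bar>\<close> of half
  the angle. In particular the density of \<open>mu\<close> is the squared modulus of \<open>Psi_m
  ground\<close>.
\<close>

lemma norm_Psi_m_ground:
  fixes x :: "real ^ 'n::{finite,linorder}"
  shows "norm (Psi_m ground x) = \<bar>Psi x\<bar>"
proof -
  define z where "z l = exp (\<i> * complex_of_real (x $ l))" for l
  define s where "s = exp (\<i> * complex_of_real (- of_int (int (CARD('n) div 2)) * (\<Sum>k\<in>UNIV. x $ k)))"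
  have "wave ground (permv p x) = s * (\<Prod>k\<in>UNIV. z (p k) ^ rank k)" if p: "p permutes UNIV" for p
  proof -
    have "(\<Sum>k\<in>UNIV. real_of_int (ground $ k) * permv p x $ k)
        = - of_int (int (CARD('n) div 2)) * (\<Sum>k\<in>UNIV. x $ k) + (\<Sum>k\<in>UNIV. real (rank k) * x $ p k)"
      using sum_permv[OF p, of "\<lambda>k. x $ k"]
      by (simp add: ground_nth sum.distrib algebra_simps sum_subtractf flip: sum_distrib_left sum_distrib_right)
    moreover have "(\<Prod>k\<in>UNIV. z (p k) ^ rank k) = exp (\<i> * complex_of_real (\<Sum>k\<in>UNIV. real (rank k) * x $ p k))"
      by (simp add: z_def exp_of_nat_mult[symmetric] exp_sum[symmetric] sum_distrib_left mult_ac)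
    ultimately show ?thesis
      unfolding wave_def s_def by (simp only: of_real_add distrib_left exp_add)
  qed
  then have "Psi_m ground x = amp TYPE('n) * twist x * s * det (\<chi> k l. z l ^ rank k :: complex ^ 'n::{finite,linorder} ^ 'n::{finite,linorder})"
    by (simp add: Psi_m_eq det_def sum_distrib_left mult_ac)
  then have "norm (Psi_m ground x) = norm (amp TYPE('n)) * (\<Prod>j\<in>UNIV. \<Prod>i\<in>{..<j}. \<bar>2 * sin ((x $ j - x $ i) / 2)\<bar>)"
    unfolding vandermonde_det
    by (simp add: norm_mult prod_norm[symmetric] z_def norm_exp_ii_diff s_def norm_exp_eq_Re)
  also have "\<dots> = (2 * pi) powr (- real CARD('n) / 2) * (\<Prod>(i, j)\<in>{(i :: 'n, j). i < j}. \<bar>2 * sin ((x $ j - x $ i) / 2)\<bar>)"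
    by (simp add: prod_pairs_less amp_def)
  also have "(\<Prod>(i, j)\<in>{(i :: 'n, j). i < j}. \<bar>2 * sin ((x $ j - x $ i) / 2)\<bar>)
      = 2 ^ card {(i :: 'n, j). i < j} * \<bar>\<Prod>(i, j)\<in>{(i, j). i < j}. sin ((x $ j - x $ i) / 2)\<bar>"
    by (simp add: abs_mult prod.distrib case_prod_unfold abs_prod)
  also have "card {(i :: 'n, j). i < j} = CARD('n) * (CARD('n) - 1) div 2"
  proof -
    have "card {(i :: 'n, j). i < j} = card (SIGMA j:(UNIV :: 'n set). {..<j})"
      by (rule bij_betw_same_card[of "\<lambda>(i, j). (j, i)"]) (auto simp: bij_betw_def inj_on_def image_iff)
    also have "\<dots> = (\<Sum>j\<in>(UNIV :: 'n set). rank j)"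
      by (simp add: card_SigmaI rank_def lessThan_def)
    also have "\<dots> = \<Sum>{..<CARD('n)}"
      using sum.reindex_bij_betw[OF bij_betw_rank[where 'n = 'n], of "\<lambda>d. d"] by simp
    also have "\<dots> = CARD('n) * (CARD('n) - 1) div 2"
      by (simp add: lessThan_atLeast0 Sum_Ico_nat)
    finally show ?thesis .
  qed
  finally show ?thesis
    by (simp add: Psi_def abs_mult powr_minus_divide powr_minus)
qed

section \<open>The quotients as symmetric trigonometric polynomials\<close>

lemma sym_wave_in_span_wave: "(sym_wave n :: real ^ 'n \<Rightarrow> complex) \<in> lin_span (range wave)"
proof -
  have "sym_wave n = (\<lambda>x. \<Sum>p | p permutes (UNIV :: 'n set). wave (permv (inv p) n) x)"
  proof
    fix x :: "real ^ 'n"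
    show "sym_wave n x = (\<Sum>p | p permutes (UNIV :: 'n set). wave (permv (inv p) n) x)"
      unfolding sym_wave_def
    proof (rule sum.cong[OF refl])
      fix p assume "p \<in> {p. p permutes (UNIV :: 'n set)}"
      then have p: "p permutes (UNIV :: 'n set)" by simp
      show "wave n (permv p x) = wave (permv (inv p) n) x"
        using wave_permv[OF p, of "permv (inv p) n" x] by (simp add: permv_inverse[OF p])
    qed
  qed
  then show ?thesis by (simp add: lin_span_sum lin_span_base)
qed

lemma span_sym_wave_subset: "lin_span (range sym_wave) \<subseteq> lin_span (range wave)"
  using lin_span_subset[of "range sym_wave" "range wave"] sym_wave_in_span_wave by blast

lemma has_derivative_wave:
  fixes n :: "int ^ 'n"
  shows "(wave n has_derivative (\<lambda>v. \<i> * complex_of_real (\<Sum>k\<in>UNIV. real_of_int (n $ k) * v $ k) * wave n x)) (at x)"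
proof -
  have lin: "bounded_linear (\<lambda>x :: real ^ 'n. \<i> * complex_of_real (\<Sum>k\<in>UNIV. real_of_int (n $ k) * x $ k))"
    by (intro bounded_linear_const_mult bounded_linear_compose[OF bounded_linear_of_real]
        bounded_linear_sum bounded_linear_vec_nth)
  show ?thesis
    using has_derivative_compose[OF bounded_linear_imp_has_derivative[OF lin]
        DERIV_exp[unfolded has_field_derivative_def]]
    unfolding wave_def[abs_def] by (simp add: mult_ac)
qed

text \<open>
  Directional derivatives of trigonometric polynomials are trigonometric polynomials, which gives
  smoothness of all orders at once.
\<close>

lemma span_wave_derivative:
  assumes "f \<in> lin_span (range (wave :: int ^ 'n \<Rightarrow> _))"
  shows "\<exists>f'. (\<forall>x. (f has_derivative f' x) (at x)) \<and> (\<forall>v. (\<lambda>x. f' x v) \<in> lin_span (range wave))"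
  using assms
proof (induction rule: lin_span_induct)
  case zero
  show ?case by (rule exI[of _ "\<lambda>_ _. 0"]) (simp add: lin_span_zero)
next
  case (step b c g)
  obtain n where b: "b = wave n" using step by blast
  obtain g' where g': "\<And>x. (g has_derivative g' x) (at x)" "\<And>v. (\<lambda>x. g' x v) \<in> lin_span (range wave)"
    using step by blast
  let ?f' = "\<lambda>x v. c * (\<i> * complex_of_real (\<Sum>k\<in>UNIV. real_of_int (n $ k) * v $ k) * wave n x) + g' x v"
  have "((\<lambda>x. c * b x + g x) has_derivative ?f' x) (at x)" for x
    unfolding b by (intro has_derivative_add has_derivative_mult_right has_derivative_wave g')
  moreover have "(\<lambda>x. ?f' x v) \<in> lin_span (range wave)" for v
    by (intro lin_span_add lin_span_cmult g' lin_span_base) auto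
  ultimately show ?case by (intro exI[of _ ?f'] conjI allI)
qed

lemma continuous_on_span_wave:
  assumes "f \<in> lin_span (range (wave :: int ^ 'n \<Rightarrow> _))"
  shows "continuous_on S f"
  using span_wave_derivative[OF assms]
  by (meson continuous_at_imp_continuous_on has_derivative_continuous)

lemma smooth_span_wave:
  assumes "f \<in> lin_span (range (wave :: int ^ 'n \<Rightarrow> _))"
  shows "smooth f"
proof -
  have "Ck k f" for k
    using assms
  proof (induction k arbitrary: f)
    case 0
    then show ?case by (simp add: continuous_on_span_wave)
  next
    case (Suc k)
    obtain f' where f': "\<And>x. (f has_derivative f' x) (at x)" "\<And>v. (\<lambda>x. f' x v) \<in> lin_span (range wave)"
      using span_wave_derivative[OF Suc.prems] by blast
    have "frechet_derivative f (at x) = f' x" for x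
      using frechet_derivative_at[OF f'(1)] by simp
    then show ?case using f' Suc.IH by (auto simp: differentiable_def)
  qed
  then show ?thesis by (simp add: smooth_def)
qed

lemma bounded_span_wave:
  assumes "f \<in> lin_span (range (wave :: int ^ 'n \<Rightarrow> _))"
  shows "\<exists>B. \<forall>x. norm (f x) \<le> B"
  using assms
proof (induction rule: lin_span_induct)
  case (step b c g)
  obtain B where B: "\<And>x. norm (g x) \<le> B" using step by blast
  have "norm (c * b x + g x) \<le> norm c + B" for x
    using step(1) B[of x] norm_triangle_ineq[of "c * b x" "g x"] by (auto simp: norm_mult)
  then show ?case by blast
qed auto

lemma on_cbar_sym_wave: "on_cbar (sym_wave n :: real ^ 'n \<Rightarrow> complex)"
  unfolding on_cbar_def
proof (intro conjI allI impI)
  fix s :: "'n \<Rightarrow> 'n" and x :: "real ^ 'n"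
  assume "bij s"
  then have s: "s permutes UNIV" using bij_imp_permutes[of s UNIV] by simp
  have "(\<chi> i. x $ s i) = permv s x" by (simp add: permv_def)
  then show "sym_wave n (\<chi> i. x $ s i) = sym_wave n x"
    using sum_permutations_compose_left[OF s, of "\<lambda>p. wave n (permv p x)"]
    by (simp add: sym_wave_def permv_permv)
next
  fix i and x :: "real ^ 'n"
  have "wave n (permv p (x + axis i (2 * pi))) = wave n (permv p x)" if p: "p permutes UNIV" for p
  proof -
    have "(\<Sum>k\<in>UNIV. real_of_int (n $ k) * permv p (x + axis i (2 * pi)) $ k)
        = (\<Sum>k\<in>UNIV. real_of_int (n $ k) * permv p x $ k) + (\<Sum>k\<in>UNIV. real_of_int (n $ k) * axis i (2 * pi) $ p k)"
      by (simp add: sum.distrib algebra_simps)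
    also have "(\<Sum>k\<in>UNIV. real_of_int (n $ k) * axis i (2 * pi) $ p k)
        = (\<Sum>k\<in>UNIV. if k = inv p i then real_of_int (n $ k) * (2 * pi) else 0)"
      using permutes_inverses[OF p] by (intro sum.cong) (auto simp: axis_def)
    also have "\<dots> = 2 * pi * of_int (n $ inv p i)" by simp
    finally have *: "(\<Sum>k\<in>UNIV. real_of_int (n $ k) * permv p (x + axis i (2 * pi)) $ k)
        = (\<Sum>k\<in>UNIV. real_of_int (n $ k) * permv p x $ k) + 2 * pi * of_int (n $ inv p i)" .
    have "exp (\<i> * complex_of_real (2 * pi * of_int (n $ inv p i))) = 1"
      unfolding cis_conv_exp[symmetric] by (rule cis_multiple_2pi) simp
    then show ?thesis
      unfolding wave_def * of_real_add distrib_left exp_add by (simp only: mult_1_right)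
  qed
  then show "sym_wave n (x + axis i (2 * pi)) = sym_wave n x"
    by (simp add: sym_wave_def)
qed

lemma on_cbar_span_sym_wave:
  assumes "f \<in> lin_span (range (sym_wave :: int ^ 'n \<Rightarrow> _))"
  shows "on_cbar f"
  using assms
proof (induction rule: lin_span_induct)
  case (step b c g)
  then have "on_cbar b" using on_cbar_sym_wave by blast
  with step show ?case by (simp add: on_cbar_def)
qed (simp add: on_cbar_def)

text \<open>
  Along the line through \<open>x\<close> in the direction of the ranks, the differences of
  coordinates move at pairwise nonzero speeds, so each factor of \<open>Psi\<close> vanishes for
  countably many times only.
\<close>

lemma Psi_nonzero_dense:
  fixes x :: "real ^ 'n::{finite,linorder}"
  assumes "e > 0"
  obtains y where "dist y x < e" "Psi y \<noteq> 0"
proof -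
  define v :: "real ^ 'n::{finite,linorder}" where "v = (\<chi> k. real (rank k))"
  define bad where "bad i j = {t. sin (((x + t *\<^sub>R v) $ j - (x + t *\<^sub>R v) $ i) / 2) = 0}" for i j
  have "countable (bad i j)" if "i < j" for i j
  proof -
    let ?d = "real (rank j) - real (rank i)"
    have "?d \<noteq> 0" using strict_monoD[OF strict_mono_rank that] by simp
    have "bad i j \<subseteq> range (\<lambda>k :: int. (2 * (of_int k * pi) - (x $ j - x $ i)) / ?d)"
    proof
      fix t assume "t \<in> bad i j"
      then obtain k :: int where "((x + t *\<^sub>R v) $ j - (x + t *\<^sub>R v) $ i) / 2 = of_int k * pi"
        unfolding bad_def sin_zero_iff_int2 by blast
      then have "t * ?d = 2 * (of_int k * pi) - (x $ j - x $ i)"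
        by (simp add: v_def algebra_simps)
      then have "t = (2 * (of_int k * pi) - (x $ j - x $ i)) / ?d"
        using \<open>?d \<noteq> 0\<close> by (simp add: field_simps)
      then show "t \<in> range (\<lambda>k :: int. (2 * (of_int k * pi) - (x $ j - x $ i)) / ?d)" by blast
    qed
    then show ?thesis by (rule countable_subset) simp
  qed
  then have "countable (\<Union>(i, j)\<in>{(i, j). i < j}. bad i j)"
    by (intro countable_UN) auto
  \<comment> \<open>Times below \<open>d\<close> keep the point within distance \<open>e\<close>; the
    \<open>1\<close> covers \<open>v = 0\<close>, which happens for \<open>N = 1\<close>.\<close>
  moreover define d where "d = e / (norm v + 1)"
  have "d > 0" using assms by (simp add: d_def add_nonneg_pos)
  then have "uncountable {0<..<d}" by (simp add: uncountable_open_interval)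
  ultimately obtain t where t: "0 < t" "t < d" "t \<notin> (\<Union>(i, j)\<in>{(i, j). i < j}. bad i j)"
    by (metis countable_subset greaterThanLessThan_iff subsetI)
  have "dist (x + t *\<^sub>R v) x = t * norm v" using t by (simp add: dist_norm)
  also have "\<dots> \<le> t * (norm v + 1)" using t by simp
  also have "\<dots> < d * (norm v + 1)" using t by (intro mult_strict_right_mono) (auto simp: add_nonneg_pos)
  also have "\<dots> = e" unfolding d_def
    using add_nonneg_pos[OF norm_ge_zero zero_less_one, of v]
    by (metis less_irrefl nonzero_divide_eq_eq)
  finally have "dist (x + t *\<^sub>R v) x < e" .
  moreover have "Psi (x + t *\<^sub>R v) \<noteq> 0"
    using t(3) by (auto simp: Psi_def bad_def)
  ultimately show ?thesis using that by blast
qed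

lemma Psi_m_ground_eq_0_iff: "Psi_m ground x = 0 \<longleftrightarrow> Psi x = 0"
  by (metis abs_eq_0 norm_Psi_m_ground norm_eq_zero)

lemma islimpt_Psi_nonzero:
  fixes x :: "real ^ 'n::{finite,linorder}"
  assumes "Psi_m ground x = 0"
  shows "x islimpt {y. Psi_m ground y \<noteq> 0}"
  unfolding islimpt_approachable
proof (intro allI impI)
  fix e :: real assume "e > 0"
  then obtain y where "dist y x < e" "Psi y \<noteq> 0" by (rule Psi_nonzero_dense)
  then show "\<exists>x'\<in>{y. Psi_m ground y \<noteq> 0}. x' \<noteq> x \<and> dist x' x < e"
    using assms by (intro bexI[of _ y]) (auto simp: Psi_m_ground_eq_0_iff)
qed

text \<open>
  A continuous \<open>P\<close> agrees with the quotient off the zeros of the denominator; these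
  have no interior, so the limit that defines \<open>S_fun\<close> at a zero is taken along a
  nontrivial filter and equals the value of \<open>P\<close>.
\<close>

lemma S_fun_eqI:
  fixes m :: "int ^ 'n::{finite,linorder}"
  assumes P: "continuous_on UNIV P" and eq: "\<And>x. Psi_m m x = P x * Psi_m ground x"
  shows "S_fun m = P"
proof
  fix x :: "real ^ 'n::{finite,linorder}"
  let ?S = "{y :: real ^ 'n::{finite,linorder}. Psi_m ground y \<noteq> 0}"
  show "S_fun m x = P x"
  proof (cases "Psi_m ground x = 0")
    case False
    then show ?thesis by (simp add: S_fun_def eq)
  next
    case True
    have "(P \<longlongrightarrow> P x) (at x within ?S)"
      using P by (metis UNIV_I continuous_on_def subset_UNIV tendsto_within_subset)
    then have "((\<lambda>y. Psi_m m y / Psi_m ground y) \<longlongrightarrow> P x) (at x within ?S)"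
      by (rule Lim_transform_within[where d = 1]) (auto simp: eq)
    moreover have "at x within ?S \<noteq> bot"
      using islimpt_Psi_nonzero[OF True] trivial_limit_within by blast
    ultimately have "Lim (at x within ?S) (\<lambda>y. Psi_m m y / Psi_m ground y) = P x"
      by (intro tendsto_Lim)
    then show ?thesis using True by (simp add: S_fun_def)
  qed
qed

lemma S_fun_in_span_sym_wave: "S_fun m \<in> lin_span (range sym_wave)"
  and S_fun_times_Psi_m_ground: "S_fun m x * Psi_m ground x = Psi_m m x"
proof -
  obtain P where P: "P \<in> lin_span (range sym_wave)" "\<And>x. Psi_m m x = P x * Psi_m ground x"
    using Psi_m_divisible by blast
  have "S_fun m = P"
    using P span_sym_wave_subset by (intro S_fun_eqI continuous_on_span_wave) auto
  with P show "S_fun m \<in> lin_span (range sym_wave)" "S_fun m x * Psi_m ground x = Psi_m m x"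
    by auto
qed

lemma S_fun_in_span_wave: "S_fun m \<in> lin_span (range wave)"
  using S_fun_in_span_sym_wave span_sym_wave_subset by blast

lemma eq_if_times_Psi_m_ground_eq:
  fixes P Q :: "real ^ 'n::{finite,linorder} \<Rightarrow> complex"
  assumes P: "continuous_on UNIV P" and Q: "continuous_on UNIV Q"
    and eq: "\<And>x. P x * Psi_m ground x = Q x * Psi_m ground x"
  shows "P = Q"
proof
  fix x
  have "closed {x. P x = Q x}" by (rule closed_Collect_eq[OF P Q])
  moreover have "x \<in> closure {x. P x = Q x}"
    unfolding closure_approachable
  proof (intro allI impI)
    fix e :: real assume "e > 0"
    then obtain y where "dist y x < e" "Psi y \<noteq> 0" by (rule Psi_nonzero_dense)
    then show "\<exists>y\<in>{x. P x = Q x}. dist y x < e"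
      using eq[of y] by (intro bexI[of _ y]) (auto simp: Psi_m_ground_eq_0_iff)
  qed
  ultimately show "P x = Q x" by simp
qed

text \<open>
  A frequency with a repeated entry gives zero, and any other one is a permutation of an element
  of the Weyl chamber.
\<close>

lemma Psi_m_in_span_weyl:
  fixes m :: "int ^ 'n::{finite,linorder}"
  shows "Psi_m m \<in> lin_span (Psi_m ` weyl_chamber)"
proof (cases "inj (\<lambda>k. m $ k)")
  case False
  then have "Psi_m m = (\<lambda>_. 0)" by (intro ext Psi_m_repeated)
  then show ?thesis by (simp add: lin_span_zero)
next
  case True
  then obtain p where p: "p permutes (UNIV :: 'n set)" "permv p m \<in> weyl_chamber"
    by (rule sort_into_weyl_chamber)
  have "Psi_m m = (\<lambda>x. of_int (sign p) * Psi_m (permv p m) x)"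
    by (intro ext) (simp add: Psi_m_permv_left[OF p(1)] sign_def)
  then show ?thesis using p(2) by (simp add: lin_span_cmult lin_span_base)
qed

lemma span_Psi_m_divide:
  assumes "f \<in> lin_span (Psi_m ` weyl_chamber)"
  shows "\<exists>g\<in>lin_span S_set. \<forall>x. f x = g x * Psi_m ground x"
  using assms
proof (induction rule: lin_span_induct)
  case zero
  show ?case by (rule bexI[OF _ lin_span_zero]) simp
next
  case (step b c f)
  then obtain g m where g: "g \<in> lin_span S_set" "\<forall>x. f x = g x * Psi_m ground x"
    and m: "m \<in> weyl_chamber" "b = Psi_m m" by blast
  have "(\<lambda>x. c * S_fun m x + g x) \<in> lin_span S_set"
    by (rule lin_span_add[OF lin_span_cmult[OF lin_span_base] g(1)]) (use m in \<open>simp add: S_set_def\<close>)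
  then show ?case
    by (rule bexI[rotated]) (simp add: m g(2) S_fun_times_Psi_m_ground[of m, symmetric] algebra_simps)
qed

lemma span_S_set_subset: "lin_span S_set \<subseteq> lin_span (range wave)"
  using lin_span_subset[of S_set "range wave"] S_fun_in_span_wave by (auto simp: S_set_def)

text \<open>
  Dividing \<open>sym_wave_times_Psi_m\<close> by the ground state; together with
  \<open>S_fun_in_span_sym_wave\<close> it shows that the quotients span exactly the symmetric
  trigonometric polynomials.
\<close>

lemma sym_wave_in_span_S_set:
  fixes n :: "int ^ 'n::{finite,linorder}"
  shows "sym_wave n \<in> lin_span S_set"
proof -
  have "(\<lambda>x. sym_wave n x * Psi_m ground x) \<in> lin_span (Psi_m ` weyl_chamber)"
    unfolding sym_wave_times_Psi_m by (intro lin_span_sum Psi_m_in_span_weyl)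
  then obtain g where g: "g \<in> lin_span S_set" "\<And>x. sym_wave n x * Psi_m ground x = g x * Psi_m ground x"
    using span_Psi_m_divide by blast
  have "sym_wave n = g"
    using g span_S_set_subset
    by (intro eq_if_times_Psi_m_ground_eq continuous_on_span_wave sym_wave_in_span_wave) auto
  with g show ?thesis by simp
qed

section \<open>Uniform approximation on the torus\<close>

lemma span_wave_mult:
  assumes "f \<in> lin_span (range wave)" "g \<in> lin_span (range wave)"
  shows "(\<lambda>x. f x * g x) \<in> lin_span (range wave)"
proof (rule lin_span_mult[OF _ assms])
  fix f g :: "real ^ 'a \<Rightarrow> complex"
  assume "f \<in> range wave" "g \<in> range wave"
  then obtain m n where "f = wave m" "g = wave n" by blast
  then have "(\<lambda>x. f x * g x) = wave (m + n)" by (simp add: wave_add fun_eq_iff)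
  then show "(\<lambda>x. f x * g x) \<in> lin_span (range wave)" by (simp add: lin_span_base)
qed

lemma span_wave_const: "(\<lambda>x. c) \<in> lin_span (range wave)"
  using lin_span_cmult[OF lin_span_base[of "wave 0" "range wave"], of c] by simp

lemma wave_axis:
  fixes x :: "real ^ 'n"
  shows "wave (axis i k) x = cis (of_int k * x $ i)"
proof -
  have "(\<Sum>j\<in>UNIV. real_of_int (axis i k $ j) * x $ j) = (\<Sum>j\<in>UNIV. if j = i then of_int k * x $ j else 0)"
    by (intro sum.cong) (auto simp: axis_def)
  then show ?thesis by (simp add: wave_def cis_conv_exp)
qed

text \<open>
  Embeds \<open>\<real>\<^sup>N\<close> modulo \<open>2\<pi>\<int>\<^sup>N\<close> into
  \<open>\<complex>\<^sup>N\<close>, so that the Stone-Weierstrass theorem for polynomials on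
  compact sets applies.
\<close>

definition torus :: "real ^ 'n \<Rightarrow> complex ^ 'n" where
  "torus x = (\<chi> i. cis (x $ i))"

text \<open>
  The coordinates of \<open>torus x\<close> are combinations of \<open>cos (x $ i)\<close> and
  \<open>sin (x $ i)\<close>, and trigonometric polynomials form an algebra.
\<close>

lemma span_wave_real_polynomial:
  fixes p :: "complex ^ 'n \<Rightarrow> real"
  assumes "real_polynomial_function p"
  shows "(\<lambda>x. complex_of_real (p (torus x))) \<in> lin_span (range wave)"
  using assms
proof (induction rule: real_polynomial_function.induct)
  case (linear h)
  interpret bounded_linear h by fact
  have cos: "(\<lambda>x. complex_of_real (cos (x $ i))) \<in> lin_span (range wave)" for i :: 'n
  proof -
    have "complex_of_real (cos (x $ i)) = (1 / 2) * (wave (axis i 1) x + wave (axis i (- 1)) x)" for x :: "real ^ 'n"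
      by (simp add: wave_axis complex_eq_iff)
    then show ?thesis by (simp only:) (intro lin_span_cmult lin_span_add lin_span_base rangeI)
  qed
  have sin: "(\<lambda>x. complex_of_real (sin (x $ i))) \<in> lin_span (range wave)" for i :: 'n
  proof -
    have "complex_of_real (sin (x $ i)) = (- \<i> / 2) * (wave (axis i 1) x + (- 1) * wave (axis i (- 1)) x)" for x :: "real ^ 'n"
      by (simp add: wave_axis complex_eq_iff)
    then show ?thesis by (simp only:) (intro lin_span_cmult lin_span_add lin_span_base rangeI)
  qed
  have "torus x = (\<Sum>i\<in>UNIV. cos (x $ i) *\<^sub>R axis i 1 + sin (x $ i) *\<^sub>R axis i \<i>)" for x :: "real ^ 'n"
  proof -
    have "(\<Sum>i\<in>UNIV. cos (x $ i) *\<^sub>R axis i 1 + sin (x $ i) *\<^sub>R axis i \<i>) $ j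
        = (\<Sum>i\<in>UNIV. if i = j then cis (x $ i) else 0)" for j
      unfolding sum_component by (intro sum.cong) (auto simp: axis_def complex_eq_iff)
    then show ?thesis by (simp add: vec_eq_iff torus_def)
  qed
  then have "complex_of_real (h (torus x)) =
      (\<Sum>i\<in>UNIV. complex_of_real (h (axis i 1)) * complex_of_real (cos (x $ i))
             + complex_of_real (h (axis i \<i>)) * complex_of_real (sin (x $ i)))" for x :: "real ^ 'n"
    by (simp add: sum add scaleR mult_ac)
  then show ?case
    by (simp only:) (intro lin_span_sum lin_span_add lin_span_cmult cos sin)
next
  case (const c)
  show ?case by (rule span_wave_const)
next
  case (add f g)
  show ?case using lin_span_add[OF add.IH] by simp
next
  case (mult f g)
  show ?case using span_wave_mult[OF mult.IH] by simp
qed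

text \<open>
  The closed box is used instead of the half-open one: it is compact, and the extra faces are null
  sets.
\<close>

definition period_box :: "(real ^ 'n) set" where
  "period_box = cbox 0 (\<chi> i. 2 * pi)"

lemma mem_period_box: "x \<in> period_box \<longleftrightarrow> (\<forall>i. 0 \<le> x $ i \<and> x $ i \<le> 2 * pi)"
  by (simp add: period_box_def mem_box_cart)

lemma compact_period_box: "compact period_box"
  by (simp add: period_box_def)

text \<open>
  The function \<open>u\<close> factors through \<open>torus\<close>. The factor \<open>F\<close>
  is continuous since \<open>torus\<close> is a closed map on the compact box, and polynomials in
  the coordinates of \<open>torus x\<close> are trigonometric. Only values on the box are used, so
  that \<open>u\<close> need not be periodic; this matters for the approximation in the mean.
\<close>

theorem trigonometric_approximation:
  fixes u :: "real ^ 'n \<Rightarrow> complex"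
  assumes u: "continuous_on period_box u"
    and glue: "\<And>x y. x \<in> period_box \<Longrightarrow> y \<in> period_box \<Longrightarrow> torus x = torus y \<Longrightarrow> u x = u y"
    and e: "e > 0"
  obtains T where "T \<in> lin_span (range wave)" "\<And>x. x \<in> period_box \<Longrightarrow> norm (u x - T x) < e"
proof -
  \<comment> \<open>Any preimage in the box serves, as \<open>u\<close> takes the same value on all of them.\<close>
  define F where "F z = u (SOME x. x \<in> period_box \<and> torus x = z)" for z
  have F: "F (torus x) = u x" if "x \<in> period_box" for x
  proof -
    have "(SOME y. y \<in> period_box \<and> torus y = torus x) \<in> period_box \<and>
        torus (SOME y. y \<in> period_box \<and> torus y = torus x) = torus x"
      by (rule someI[of _ x]) (use that in simp)
    then show ?thesis unfolding F_def using glue that by blast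
  qed
  have torus: "continuous_on S torus" for S :: "(real ^ 'n) set"
    unfolding torus_def by (intro continuous_intros)
  have "compact (torus ` (period_box :: (real ^ 'n) set))"
    by (rule compact_continuous_image[OF torus compact_period_box])
  moreover have "continuous_on (torus ` period_box) F"
  proof (subst continuous_on_closed_vimage)
    show "closed (torus ` (period_box :: (real ^ 'n) set))"
      using \<open>compact (torus ` period_box)\<close> by (rule compact_imp_closed)
    show "\<forall>B. closed B \<longrightarrow> closed (F -` B \<inter> torus ` period_box)"
    proof (intro allI impI)
      fix B :: "complex set" assume "closed B"
      then have "closed (u -` B \<inter> period_box)"
        using u continuous_on_closed_vimage[OF compact_imp_closed[OF compact_period_box], of u] by blast
      then have "compact (period_box \<inter> (u -` B \<inter> period_box))"
        by (rule compact_Int_closed[OF compact_period_box])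
      then have "compact (torus ` (period_box \<inter> (u -` B \<inter> period_box)))"
        by (rule compact_continuous_image[OF torus])
      moreover have "F -` B \<inter> torus ` period_box = torus ` (period_box \<inter> (u -` B \<inter> period_box))"
        using F by auto
      ultimately show "closed (F -` B \<inter> torus ` period_box)"
        by (simp add: compact_imp_closed)
    qed
  qed
  ultimately obtain g where g: "polynomial_function g"
    "\<And>z. z \<in> torus ` period_box \<Longrightarrow> norm (F z - g z) < e"
    using Stone_Weierstrass_polynomial_function[of "torus ` period_box" F e] e by blast
  have "real_polynomial_function (Re \<circ> g)" "real_polynomial_function (Im \<circ> g)"
    using g(1) bounded_linear_Re bounded_linear_Im by (auto simp: polynomial_function_def)
  note parts = this[THEN span_wave_real_polynomial]
  have "(\<lambda>x. g (torus x)) \<in> lin_span (range wave)"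
    using lin_span_add[OF parts(1) lin_span_cmult[OF parts(2), of \<i>]] by (simp add: complex_eq[symmetric])
  moreover have "norm (u x - g (torus x)) < e" if "x \<in> period_box" for x
    using g(2)[of "torus x"] F[OF that] that by auto
  ultimately show ?thesis using that by blast
qed

lemma on_cbar_periodic:
  fixes f :: "real ^ 'n \<Rightarrow> complex"
  assumes f: "on_cbar f"
  shows "f (x + (\<chi> i. 2 * pi * of_int (n $ i))) = f x"
proof -
  have nat: "f (x + axis i (2 * pi * real k)) = f x" for i x k
  proof (induction k)
    case 0
    then show ?case by (simp add: axis_def zero_vec_def[symmetric])
  next
    case (Suc k)
    have "axis i (2 * pi * real (Suc k)) = axis i (2 * pi * real k) + axis i (2 * pi)"
      by (simp add: vec_eq_iff axis_def algebra_simps)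
    then show ?case using f Suc by (simp add: on_cbar_def add.assoc[symmetric])
  qed
  have int: "f (x + axis i (2 * pi * of_int k)) = f x" for i x and k :: int
  proof (cases "k \<ge> 0")
    case True
    then show ?thesis using nat[of x i "nat k"] by simp
  next
    case False
    have *: "x + axis i (2 * pi * of_int k) + axis i (2 * pi * real (nat (- k))) = x"
      using False by (simp add: vec_eq_iff axis_def)
    show ?thesis using nat[of "x + axis i (2 * pi * of_int k)" i "nat (- k)"] unfolding * by simp
  qed
  have "f (x + (\<Sum>i\<in>A. axis i (2 * pi * of_int (n $ i)))) = f x" if "finite A" for A
    using that
  proof (induction A)
    case (insert i A)
    then show ?case
      using int[of "x + (\<Sum>i\<in>A. axis i (2 * pi * of_int (n $ i)))" i "n $ i"] by (simp add: add_ac)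
  qed simp
  moreover have "(\<Sum>i\<in>UNIV. axis i (2 * pi * of_int (n $ i))) = (\<chi> i. 2 * pi * real_of_int (n $ i))"
    by (simp add: vec_eq_iff sum_component axis_def)
  ultimately show ?thesis using finite[of UNIV] by metis
qed

lemma torus_eqD:
  fixes x y :: "real ^ 'n"
  assumes "torus x = torus y"
  obtains n :: "int ^ 'n" where "x = y + (\<chi> i. 2 * pi * of_int (n $ i))"
proof -
  have "\<exists>n :: int. x $ i = y $ i + 2 * pi * n" for i
  proof -
    have "cis (x $ i) = cis (y $ i)" using assms by (simp add: torus_def vec_eq_iff)
    then show ?thesis by (simp add: complex_eq_iff flip: sin_cos_eq_iff)
  qed
  then obtain n :: "'n \<Rightarrow> int" where "\<And>i. x $ i = y $ i + 2 * pi * n i" by metis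
  then have "x = y + (\<chi> i. 2 * pi * of_int ((\<chi> i. n i) $ i))" by (simp add: vec_eq_iff)
  then show ?thesis using that by blast
qed

lemma reduce_to_period_box:
  fixes x :: "real ^ 'n"
  obtains y and n :: "int ^ 'n" where "y \<in> period_box" "x = y + (\<chi> i. 2 * pi * of_int (n $ i))"
proof -
  let ?n = "\<chi> i. \<lfloor>x $ i / (2 * pi)\<rfloor>"
  let ?y = "x - (\<chi> i. 2 * pi * of_int (?n $ i))"
  have "0 \<le> ?y $ i \<and> ?y $ i \<le> 2 * pi" for i
  proof -
    define k where "k = \<lfloor>x $ i / (2 * pi)\<rfloor>"
    have "of_int k \<le> x $ i / (2 * pi)" "x $ i / (2 * pi) \<le> of_int k + 1"
      unfolding k_def by linarith+
    moreover have "?y $ i = x $ i - 2 * pi * of_int k" by (simp add: k_def)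
    ultimately show ?thesis by (simp only:) (simp add: field_simps)
  qed
  then have "?y \<in> period_box" by (simp add: mem_period_box)
  then show ?thesis using that[of ?y ?n] by simp
qed

lemma symmetrize_in_span:
  fixes T :: "real ^ 'n \<Rightarrow> complex"
  assumes "T \<in> lin_span (range wave)"
  shows "(\<lambda>x. \<Sum>p | p permutes UNIV. T (permv p x)) \<in> lin_span (range sym_wave)"
  using assms
proof (induction rule: lin_span_induct)
  case zero
  then show ?case by (simp add: lin_span_zero)
next
  case (step b c g)
  then obtain n where b: "b = wave n" by blast
  have "(\<lambda>x. c * sym_wave n x + (\<Sum>p | p permutes UNIV. g (permv p x))) \<in> lin_span (range sym_wave)"
    by (intro lin_span_add lin_span_cmult step lin_span_base rangeI)
  moreover have "(\<lambda>x. \<Sum>p | p permutes UNIV. c * b (permv p x) + g (permv p x))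
      = (\<lambda>x. c * sym_wave n x + (\<Sum>p | p permutes UNIV. g (permv p x)))"
    by (simp add: b sym_wave_def sum.distrib sum_distrib_left)
  ultimately show ?case by (simp only:)
qed

text \<open>
  Averaging a trigonometric approximant over all permutations does not increase its distance to a
  symmetric function and turns it into a combination of \<open>sym_wave\<close>s.
\<close>

theorem span_S_set_uniformly_dense:
  fixes f :: "real ^ 'n::{finite,linorder} \<Rightarrow> complex"
  assumes f: "f \<in> C_cbar" and e: "e > 0"
  shows "\<exists>g\<in>lin_span S_set. \<forall>x. norm (f x - g x) < e"
proof -
  have cbar: "on_cbar f" and cont: "continuous_on UNIV f" using f by (auto simp: C_cbar_def)
  have glue: "f x = f y" if "x \<in> period_box" "y \<in> period_box" "torus x = torus y" for x y
    using torus_eqD[OF that(3)] on_cbar_periodic[OF cbar] by metis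
  have e2: "0 < e / 2" using e by simp
  obtain T where T: "T \<in> lin_span (range wave)" "\<And>x. x \<in> period_box \<Longrightarrow> norm (f x - T x) < e / 2"
    by (rule trigonometric_approximation[OF continuous_on_subset[OF cont subset_UNIV] glue e2]) (auto intro: that)
  let ?S = "{p. p permutes (UNIV :: 'n set)}"
  define c where "c = real (card ?S)"
  have c: "c > 0"
    unfolding c_def by (auto simp: card_gt_0_iff intro: exI[of _ id] permutes_id)
  define g where "g x = of_real (1 / c) * (\<Sum>p\<in>?S. T (permv p x))" for x
  have g: "g \<in> lin_span (range sym_wave)"
    unfolding g_def[abs_def] by (intro lin_span_cmult symmetrize_in_span T)
  have box: "norm (f x - g x) < e" if x: "x \<in> period_box" for x
  proof -
    have "f x = of_real (1 / c) * (of_real c * f x)"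
      using c by simp
    also have "of_real c * f x = (\<Sum>p\<in>?S. f x)" by (simp add: c_def)
    also have "(\<Sum>p\<in>?S. f x) = (\<Sum>p\<in>?S. f (permv p x))"
      using cbar by (intro sum.cong) (auto simp: on_cbar_def permv_def permutes_bij)
    finally have "f x - g x = of_real (1 / c) * (\<Sum>p\<in>?S. f (permv p x) - T (permv p x))"
      by (simp only: g_def sum_subtractf right_diff_distrib)
    then have "norm (f x - g x) = 1 / c * norm (\<Sum>p\<in>?S. f (permv p x) - T (permv p x))"
      using c by (simp add: norm_mult norm_divide)
    also have "\<dots> \<le> 1 / c * (\<Sum>p\<in>?S. e / 2)"
      using x c by (intro mult_left_mono sum_norm_le less_imp_le T(2)) (auto simp: mem_period_box)
    also have "(\<Sum>p\<in>?S. e / 2) = c * (e / 2)" by (simp add: c_def)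
    also have "1 / c * (c * (e / 2)) = e / 2" using c by simp
    finally show ?thesis using e by simp
  qed
  have "norm (f x - g x) < e" for x
  proof -
    obtain y and n :: "int ^ 'n::{finite,linorder}" where y: "y \<in> period_box" "x = y + (\<chi> i. 2 * pi * of_int (n $ i))"
      by (rule reduce_to_period_box)
    then show ?thesis
      using box[OF y(1)] on_cbar_periodic[OF cbar] on_cbar_periodic[OF on_cbar_span_sym_wave[OF g]] by simp
  qed
  moreover have "g \<in> lin_span S_set"
    using lin_span_subset[OF _ g] sym_wave_in_span_S_set by blast
  ultimately show ?thesis by blast
qed

section \<open>Unfolding the period box into configurations\<close>

lemma measurable_vec_nth [measurable]: "(\<lambda>x :: real ^ 'n. x $ i) \<in> borel_measurable borel"
  by (intro borel_measurable_continuous_onI continuous_intros)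

lemma config_borel [measurable]: "config \<in> sets (borel :: (real ^ 'n::{finite,linorder}) measure)"
proof -
  have "{x \<in> space borel. (\<forall>i. 0 \<le> x $ i \<and> x $ i < 2 * pi) \<and> (\<forall>i j. i < j \<longrightarrow> x $ i < x $ j)} \<in> sets (borel :: (real ^ 'n::{finite,linorder}) measure)"
    by measurable
  then show ?thesis by (simp add: config_def)
qed

lemma period_box_borel [measurable]: "period_box \<in> sets (borel :: (real ^ 'n) measure)"
  by (simp add: period_box_def)

lemma config_subset_period_box: "config \<subseteq> period_box"
  by (auto simp: config_def mem_period_box less_imp_le)

lemma continuous_on_permv: "continuous_on S (permv p :: real ^ 'n \<Rightarrow> real ^ 'n)"
  unfolding permv_def by (intro continuous_intros)

lemma measurable_permv [measurable]: "permv p \<in> borel_measurable (borel :: (real ^ 'n) measure)"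
  by (intro borel_measurable_continuous_onI continuous_on_permv)

lemma prod_Basis_vec:
  fixes f :: "real ^ 'n \<Rightarrow> 'b::comm_monoid_mult"
  shows "(\<Prod>b\<in>Basis. f b) = (\<Prod>i\<in>UNIV. f (axis i 1))"
proof -
  have Basis: "(Basis :: (real ^ 'n) set) = range (\<lambda>i. axis i 1)"
    by (auto simp: Basis_vec_def)
  have inj: "inj (\<lambda>i :: 'n. axis i (1 :: real))" by (auto simp: inj_def axis_eq_axis)
  show ?thesis unfolding Basis prod.reindex[OF inj] by simp
qed

text \<open>
  Lebesgue measure is determined by its values on boxes, and a permutation of coordinates maps
  boxes to boxes of the same volume.
\<close>

lemma distr_lborel_permv:
  assumes p: "p permutes (UNIV :: 'n::finite set)"
  shows "distr lborel borel (permv p) = (lborel :: (real ^ 'n) measure)"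
proof (rule lborel_eqI[symmetric])
  fix l u :: "real ^ 'n"
  assume lu: "\<And>b. b \<in> Basis \<Longrightarrow> l \<bullet> b \<le> u \<bullet> b"
  have le: "l $ i \<le> u $ i" for i
    using lu[of "axis i 1"] by (simp add: inner_axis Basis_vec_def) blast
  let ?l = "permv (inv p) l" and ?u = "permv (inv p) u"
  have "permv p -` box l u = box ?l ?u"
    using permutes_inverses[OF p] by (auto simp: mem_box_cart) metis+
  then have "emeasure (distr lborel borel (permv p)) (box l u) = emeasure lborel (box ?l ?u)"
    by (simp add: emeasure_distr)
  also have "\<dots> = ennreal (\<Prod>b\<in>Basis. (?u - ?l) \<bullet> b)"
    using le by (intro emeasure_lborel_box) (auto simp: Basis_vec_def inner_axis)
  also have "(\<Prod>b\<in>Basis. (?u - ?l) \<bullet> b) = (\<Prod>b\<in>Basis. (u - l) \<bullet> b)"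
    using prod.permute[OF permutes_inv[OF p], of "\<lambda>i. u $ i - l $ i"]
    by (simp add: prod_Basis_vec inner_axis o_def)
  finally show "emeasure (distr lborel borel (permv p)) (box l u) = (\<Prod>b\<in>Basis. (u - l) \<bullet> b)" .
qed simp

lemma null_sets_hyperplane:
  fixes a :: "real ^ 'n"
  assumes "a \<noteq> 0"
  shows "{x. a \<bullet> x = b} \<in> null_sets lborel"
proof -
  have "{x. a \<bullet> x = b} \<in> null_sets (completion lborel)"
    using negligible_hyperplane[of a b] assms by (simp add: negligible_iff_null_sets)
  then show ?thesis
    by (subst (asm) null_sets_completion_iff) (simp_all add: closed_hyperplane borel_closed)
qed

lemma AE_coord_neq: "AE x in lborel. x $ i \<noteq> (c :: real)"
proof -
  have "{x. axis i (1 :: real) \<bullet> x = c} \<in> null_sets lborel"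
    by (rule null_sets_hyperplane) (simp add: axis_eq_0_iff)
  then show ?thesis by (rule AE_I') (auto simp: inner_axis')
qed

lemma AE_coords_distinct: "AE x :: real ^ 'n in lborel. \<forall>i j. i \<noteq> j \<longrightarrow> x $ i \<noteq> x $ j"
proof -
  have "AE x :: real ^ 'n in lborel. x $ i \<noteq> x $ j" if "i \<noteq> j" for i j
  proof -
    have "axis i 1 - axis j (1 :: real) \<noteq> 0" using that by (auto simp: axis_eq_axis)
    then have "{x. (axis i 1 - axis j (1 :: real)) \<bullet> x = 0} \<in> null_sets lborel" by (rule null_sets_hyperplane)
    then show ?thesis by (rule AE_I') (auto simp: inner_diff_left inner_axis')
  qed
  then show ?thesis by (simp add: AE_all_countable)
qed

text \<open>
  Two rearrangements of \<open>x\<close> in \<open>config\<close> are sorted, hence equal, and the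
  entries are distinct.
\<close>

lemma config_permv_unique:
  fixes x :: "real ^ 'n::{finite,linorder}"
  assumes p: "p permutes UNIV" and q: "q permutes UNIV"
    and x: "permv p x \<in> config" "permv q x \<in> config"
  shows "q = p"
proof -
  let ?h = "\<lambda>k. permv p x $ k" and ?r = "inv p \<circ> q"
  have r: "?r permutes UNIV" using p q by (intro permutes_compose permutes_inv)
  have mono: "mono (\<lambda>k. y $ k)" if "y \<in> config" for y :: "real ^ 'n::{finite,linorder}"
    using that by (intro monoI) (auto simp: config_def le_less)
  have hr: "?h \<circ> ?r = (\<lambda>k. permv q x $ k)"
    using permutes_inverses[OF p] by auto
  have "?h \<circ> ?r = ?h"
    using mono[OF x(1)] mono[OF x(2)] unfolding hr[symmetric] by (intro mono_rearrangement_unique[OF r])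
  then have eq: "x $ q k = x $ p k" for k
    unfolding hr by (simp add: fun_eq_iff)
  have "inj (\<lambda>k. permv p x $ k)"
    using x(1) by (intro strict_mono_on_imp_inj_on strict_monoI) (auto simp: config_def)
  then have "inj (\<lambda>k. x $ p k)" by simp
  moreover have "x $ p (inv p (q k)) = x $ p k" for k
    using eq permutes_inverses[OF p] by simp
  ultimately have "inv p (q k) = k" for k by (rule injD)
  then show "q = p" using permutes_inverses[OF p] by (metis ext)
qed

text \<open>
  Off the hyperplanes \<open>x\<^sub>i = x\<^sub>j\<close> and \<open>x\<^sub>i = 2\<pi>\<close>
  exactly one rearrangement of a point of the box is a configuration: the copies of
  \<open>config\<close> under permutations tile the box up to a null set.
\<close>

lemma indicator_period_box_eq:
  "AE x :: real ^ 'n::{finite,linorder} in lborel.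
     (indicator period_box x :: real) = (\<Sum>p | p permutes UNIV. indicator config (permv p x))"
proof -
  have "AE x :: real ^ 'n::{finite,linorder} in lborel. \<forall>i. x $ i \<noteq> 2 * pi"
    by (simp add: AE_all_countable AE_coord_neq)
  then show ?thesis
    using AE_coords_distinct
  proof eventually_elim
    case (elim x)
    let ?S = "{p. p permutes (UNIV :: 'n set)}"
    show ?case
    proof (cases "x \<in> period_box")
      case False
      have "permv p x \<notin> config" if p: "p permutes UNIV" for p
      proof
        assume "permv p x \<in> config"
        then have "0 \<le> x $ p i \<and> x $ p i < 2 * pi" for i by (simp add: config_def)
        then have "0 \<le> x $ i \<and> x $ i < 2 * pi" for i by (metis p permutes_inverses(1))
        then show False using False by (auto simp: mem_period_box less_imp_le)
      qed
      then show ?thesis using False by (simp add: sum.neutral)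
    next
      case True
      obtain p where p: "p permutes (UNIV :: 'n set)" "mono ((\<lambda>k. x $ k) \<circ> p)"
        by (rule sorting_permutation)
      have "permv p x \<in> config"
      proof -
        have "x $ p i < x $ p j" if "i < j" for i j
        proof -
          have "x $ p i \<le> x $ p j" using p(2) that by (auto dest: monoD[of _ i j])
          moreover have "x $ p i \<noteq> x $ p j"
            using elim(2) permutes_inj[OF p(1)] that by (metis injD less_irrefl)
          ultimately show ?thesis by simp
        qed
        then show ?thesis using True elim(1)
          by (auto simp: config_def mem_period_box order_le_less)
      qed
      then have "permv q x \<in> config \<longleftrightarrow> q = p" if "q \<in> ?S" for q
        using config_permv_unique[OF p(1), of q x] that by blast
      then have "(\<Sum>q\<in>?S. indicator config (permv q x) :: real) = (\<Sum>q\<in>?S. if q = p then 1 else 0)"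
        by (intro sum.cong refl) (simp add: indicator_def)
      also have "\<dots> = 1" using p(1) by simp
      finally show ?thesis using True by simp
    qed
  qed
qed

text \<open>
  Each tile of the box is moved onto \<open>config\<close> by a measure-preserving permutation of
  coordinates.
\<close>

theorem integral_period_box_unfold:
  fixes g :: "real ^ 'n::{finite,linorder} \<Rightarrow> 'b::{banach,second_countable_topology}"
  assumes [measurable]: "g \<in> borel_measurable borel"
    and g: "integrable lborel (\<lambda>x. indicator period_box x *\<^sub>R g x)"
  shows "integrable lborel (\<lambda>x. indicator config x *\<^sub>R (\<Sum>p | p permutes UNIV. g (permv p x)))" (is ?int)
    and "(\<integral>x. indicator period_box x *\<^sub>R g x \<partial>lborel)
       = (\<integral>x. indicator config x *\<^sub>R (\<Sum>p | p permutes UNIV. g (permv p x)) \<partial>lborel)" (is ?eq)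
proof -
  let ?S = "{p. p permutes (UNIV :: 'n set)}"
  have int1: "integrable lborel (\<lambda>x. indicator config (permv p x) *\<^sub>R g x)" if "p \<in> ?S" for p
  proof (rule Bochner_Integration.integrable_bound[OF g])
    have p: "p permutes UNIV" using that by simp
    have "x \<in> period_box" if "permv p x \<in> config" for x
    proof -
      from that have "permv p x \<in> period_box" using config_subset_period_box by blast
      then have "0 \<le> x $ p i \<and> x $ p i \<le> 2 * pi" for i by (simp add: mem_period_box)
      then show ?thesis unfolding mem_period_box by (metis p permutes_inverses(1))
    qed
    then show "AE x in lborel. norm (indicator config (permv p x) *\<^sub>R g x) \<le> norm (indicator period_box x *\<^sub>R g x)"
      by (intro AE_I2) (auto simp: indicator_def)
  qed measurable
  have move: "integrable lborel (\<lambda>y. indicator config y *\<^sub>R g (permv (inv p) y))"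
    "(\<integral>x. indicator config (permv p x) *\<^sub>R g x \<partial>lborel) = (\<integral>y. indicator config y *\<^sub>R g (permv (inv p) y) \<partial>lborel)"
    if "p \<in> ?S" for p
  proof -
    have p: "p permutes UNIV" using that by simp
    let ?h = "\<lambda>y. indicator config y *\<^sub>R g (permv (inv p) y)"
    have h: "?h (permv p x) = indicator config (permv p x) *\<^sub>R g x" for x
      by (simp add: permv_inverse[OF p])
    have "integrable (distr lborel borel (permv p)) ?h"
      using int1[OF that] by (subst integrable_distr_eq) (simp_all add: permv_inverse[OF p])
    then show "integrable lborel ?h" by (simp add: distr_lborel_permv[OF p])
    have "integral\<^sup>L (distr lborel borel (permv p)) ?h = (\<integral>x. ?h (permv p x) \<partial>lborel)"
      by (rule integral_distr) measurable
    then show "(\<integral>x. indicator config (permv p x) *\<^sub>R g x \<partial>lborel) = integral\<^sup>L lborel ?h"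
      unfolding h by (simp add: distr_lborel_permv[OF p])
  qed
  have sum: "(\<Sum>p\<in>?S. indicator config y *\<^sub>R g (permv (inv p) y)) = indicator config y *\<^sub>R (\<Sum>p\<in>?S. g (permv p y))" for y
    unfolding scaleR_sum_right[symmetric] using sum_permutations_inv[of "\<lambda>p. g (permv p y)"] by simp
  have "integrable lborel (\<lambda>y. \<Sum>p\<in>?S. indicator config y *\<^sub>R g (permv (inv p) y))"
    by (intro Bochner_Integration.integrable_sum move)
  then show ?int unfolding sum .
  have "(\<integral>x. indicator period_box x *\<^sub>R g x \<partial>lborel)
      = (\<integral>x. (\<Sum>p\<in>?S. indicator config (permv p x) *\<^sub>R g x) \<partial>lborel)"
  proof (rule integral_cong_AE)
    show "AE x in lborel. indicator period_box x *\<^sub>R g x = (\<Sum>p\<in>?S. indicator config (permv p x) *\<^sub>R g x)"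
      using indicator_period_box_eq by eventually_elim (simp add: scaleR_sum_left)
  qed measurable
  also have "\<dots> = (\<Sum>p\<in>?S. \<integral>x. indicator config (permv p x) *\<^sub>R g x \<partial>lborel)"
    by (intro Bochner_Integration.integral_sum int1)
  also have "\<dots> = (\<Sum>p\<in>?S. \<integral>y. indicator config y *\<^sub>R g (permv (inv p) y) \<partial>lborel)"
    by (intro sum.cong refl move)
  also have "\<dots> = (\<integral>y. (\<Sum>p\<in>?S. indicator config y *\<^sub>R g (permv (inv p) y)) \<partial>lborel)"
    by (intro Bochner_Integration.integral_sum[symmetric] move)
  finally show ?eq unfolding sum .
qed

section \<open>Orthonormality\<close>

lemma integral_lborel_prod:
  fixes f :: "'a::euclidean_space \<Rightarrow> real \<Rightarrow> complex"
  assumes f: "\<And>b. b \<in> Basis \<Longrightarrow> integrable lborel (f b)"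
  shows "(\<integral>x. (\<Prod>b\<in>Basis. f b (x \<bullet> b)) \<partial>lborel) = (\<Prod>b\<in>Basis. \<integral>t. f b t \<partial>lborel)"
proof -
  interpret product_sigma_finite "\<lambda>_ :: 'a. lborel :: real measure" ..
  have [measurable]: "f b \<in> borel_measurable borel" if "b \<in> Basis" for b
    using borel_measurable_integrable[OF f[OF that]] by simp
  have "(\<integral>x. (\<Prod>b\<in>Basis. f b (x b)) \<partial>(\<Pi>\<^sub>M b\<in>Basis. lborel)) = (\<Prod>b\<in>Basis. \<integral>t. f b t \<partial>lborel)"
    by (rule product_integral_prod) (simp_all add: f)
  moreover have lborel: "(lborel :: 'a measure) = distr (\<Pi>\<^sub>M b\<in>Basis. lborel) borel (\<lambda>x. \<Sum>b\<in>Basis. x b *\<^sub>R b)"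
    by (subst lborel_def) (simp add: lborel_eq_real)
  ultimately show ?thesis
    by (subst lborel, subst integral_distr) simp_all
qed

lemma integral_cis_period:
  "(\<integral>t. indicator {0..2 * pi} t *\<^sub>R cis (of_int k * t) \<partial>lborel) = (if k = 0 then of_real (2 * pi) else 0)"
  "integrable lborel (\<lambda>t. indicator {0..2 * pi} t *\<^sub>R cis (of_int k * t))"
proof -
  have cont: "continuous_on S (\<lambda>t. cis (of_int k * t))" for S
    by (intro continuous_intros)
  show "integrable lborel (\<lambda>t. indicator {0..2 * pi} t *\<^sub>R cis (of_int k * t))"
    by (rule borel_integrable_compact[OF _ cont]) simp
  show "(\<integral>t. indicator {0..2 * pi} t *\<^sub>R cis (of_int k * t) \<partial>lborel) = (if k = 0 then of_real (2 * pi) else 0)"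
  proof (cases "k = 0")
    case True
    have "(\<integral>t. indicator {0..2 * pi} t *\<^sub>R (1 :: complex) \<partial>lborel) = of_real (2 * pi) - of_real 0"
      by (rule integral_FTC_Icc[where F = of_real])
        (auto intro!: derivative_eq_intros simp: has_vector_derivative_def scaleR_conv_of_real)
    then show ?thesis using True by simp
  next
    case False
    let ?F = "\<lambda>t. cis (of_int k * t) / (\<i> * of_int k)"
    have "(?F has_vector_derivative cis (of_int k * t)) (at t within A)" for t A
    proof -
      have "((\<lambda>z. exp (\<i> * of_int k * z) / (\<i> * of_int k)) has_field_derivative exp (\<i> * of_int k * of_real t)) (at (of_real t))"
        using False by (auto intro!: derivative_eq_intros)
      from has_vector_derivative_real_field[OF this] show ?thesis
        by (simp add: cis_conv_exp mult.assoc)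
    qed
    then have "(\<integral>t. indicator {0..2 * pi} t *\<^sub>R cis (of_int k * t) \<partial>lborel) = ?F (2 * pi) - ?F 0"
      by (intro integral_FTC_Icc cont) auto
    also have "cis (of_int k * (2 * pi)) = 1"
      using cis_multiple_2pi[of "of_int k"] by (simp add: mult_ac)
    finally show ?thesis using False by simp
  qed
qed

text \<open>
  The integrand is a product of functions of single coordinates, each of which is integrated over
  a full period.
\<close>

lemma integral_wave:
  fixes n :: "int ^ 'n"
  shows "(\<integral>x. indicator period_box x *\<^sub>R wave n x \<partial>lborel) = (if n = 0 then of_real ((2 * pi) ^ CARD('n)) else 0)"
proof -
  \<comment> \<open>Fubini is stated over \<open>Basis\<close>; the description operator recovers the index of a
    basis vector.\<close>
  define f where "f b t = indicator {0..2 * pi} t *\<^sub>R cis (of_int (n $ (THE i. b = axis i (1 :: real))) * t)"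
    for b :: "real ^ 'n" and t
  have the: "(THE j. axis i (1 :: real) = axis j 1) = i" for i :: 'n
    by (rule the_equality) (auto simp: axis_eq_axis)
  have "indicator period_box x *\<^sub>R wave n x = (\<Prod>b\<in>Basis. f b (x \<bullet> b))" for x
  proof -
    have "(\<Prod>b\<in>Basis. f b (x \<bullet> b)) = (\<Prod>i\<in>UNIV. indicator {0..2 * pi} (x $ i) *\<^sub>R cis (of_int (n $ i) * x $ i))"
      by (simp add: prod_Basis_vec f_def the inner_axis)
    also have "\<dots> = (\<Prod>i\<in>UNIV. of_real (indicator {0..2 * pi} (x $ i))) * (\<Prod>i\<in>UNIV. cis (of_int (n $ i) * x $ i))"
      by (simp add: scaleR_conv_of_real prod.distrib)
    also have "(\<Prod>i\<in>UNIV. of_real (indicator {0..2 * pi} (x $ i)) :: complex) = of_real (indicator period_box x)"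
    proof (cases "x \<in> period_box")
      case True
      then show ?thesis by (simp add: mem_period_box)
    next
      case False
      then obtain i where "\<not> (0 \<le> x $ i \<and> x $ i \<le> 2 * pi)" by (auto simp: mem_period_box)
      then have "(\<Prod>i\<in>UNIV. of_real (indicator {0..2 * pi} (x $ i)) :: complex) = 0"
        by (intro prod_zero bexI[of _ i]) auto
      then show ?thesis using False by simp
    qed
    also have "(\<Prod>i\<in>UNIV. cis (of_int (n $ i) * x $ i)) = wave n x"
      by (simp add: wave_def cis_conv_exp exp_sum[symmetric] sum_distrib_left)
    finally show ?thesis by (simp add: scaleR_conv_of_real)
  qed
  moreover have "integrable lborel (f b)" for b
    unfolding f_def[abs_def] by (rule integral_cis_period)
  ultimately have "(\<integral>x. indicator period_box x *\<^sub>R wave n x \<partial>lborel) = (\<Prod>b\<in>Basis. \<integral>t. f b t \<partial>lborel)"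
    by (simp add: integral_lborel_prod)
  also have "\<dots> = (\<Prod>i\<in>UNIV. if n $ i = 0 then of_real (2 * pi) else 0)"
    by (simp add: prod_Basis_vec f_def the integral_cis_period)
  also have "\<dots> = (if n = 0 then of_real ((2 * pi) ^ CARD('n)) else 0)"
    by (auto simp: vec_eq_iff)
  finally show ?thesis .
qed

lemma continuous_on_twist: "continuous_on S (twist :: real ^ 'n \<Rightarrow> complex)"
  unfolding twist_def[abs_def] by (intro continuous_intros)

lemma continuous_on_wave: "continuous_on S (wave n)"
  by (intro continuous_on_span_wave lin_span_base rangeI)

lemma continuous_on_Psi_m:
  fixes m :: "int ^ 'n::{finite,linorder}"
  shows "continuous_on S (Psi_m m)"
  unfolding Psi_m_eq[abs_def]
  by (intro continuous_intros continuous_on_twist continuous_on_compose2[OF continuous_on_wave continuous_on_permv]) auto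

lemma measurable_Psi_m [measurable]:
  fixes m :: "int ^ 'n::{finite,linorder}"
  shows "Psi_m m \<in> borel_measurable borel"
  by (intro borel_measurable_continuous_onI continuous_on_Psi_m)

lemma measurable_twist [measurable]: "twist \<in> borel_measurable borel"
  by (intro borel_measurable_continuous_onI continuous_on_twist)

lemma measurable_wave [measurable]: "wave n \<in> borel_measurable borel"
  by (intro borel_measurable_continuous_onI continuous_on_wave)

lemma measurable_span_wave:
  assumes "T \<in> lin_span (range wave)" shows "T \<in> borel_measurable borel"
  by (intro borel_measurable_continuous_onI continuous_on_span_wave assms)

lemma integrable_period_box_continuous:
  fixes f :: "real ^ 'n \<Rightarrow> 'b::{banach,second_countable_topology}"
  assumes "continuous_on UNIV f"
  shows "integrable lborel (\<lambda>x. indicator period_box x *\<^sub>R f x)"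
  by (rule borel_integrable_compact[OF compact_period_box continuous_on_subset[OF assms]]) simp

lemma integrable_config_continuous:
  fixes f :: "real ^ 'n::{finite,linorder} \<Rightarrow> 'b::{banach,second_countable_topology}"
  assumes f: "continuous_on UNIV f"
  shows "integrable lborel (\<lambda>x. indicator config x *\<^sub>R f x)"
proof (rule Bochner_Integration.integrable_bound[OF integrable_period_box_continuous[OF f]])
  have [measurable]: "f \<in> borel_measurable borel" by (rule borel_measurable_continuous_onI[OF f])
  show "(\<lambda>x. indicator config x *\<^sub>R f x) \<in> borel_measurable lborel" by measurable
  show "AE x in lborel. norm (indicator config x *\<^sub>R f x) \<le> norm (indicator period_box x *\<^sub>R f x)"
    using config_subset_period_box by (intro AE_I2) (auto simp: indicator_def)
qed

lemma amp_normalization: "amp TYPE('n::finite) * cnj (amp TYPE('n)) * of_real ((2 * pi) ^ CARD('n)) = 1"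
proof -
  have "- real CARD('n) / 2 + - real CARD('n) / 2 = - real CARD('n)" by simp
  then have "(2 * pi) powr (- real CARD('n) / 2) * (2 * pi) powr (- real CARD('n) / 2) = (2 * pi) powr (- real CARD('n))"
    by (simp only: powr_add[symmetric])
  also have "\<dots> = inverse ((2 * pi) ^ CARD('n))"
    by (simp only: powr_minus powr_realpow[of "2 * pi"] pi_gt_zero mult_pos_pos zero_less_numeral)
  finally have "(2 * pi) powr (- real CARD('n) / 2) * (2 * pi) powr (- real CARD('n) / 2) * (2 * pi) ^ CARD('n) = 1"
    by (simp only:) (rule left_inverse, simp)
  then show ?thesis
    unfolding amp_def complex_cnj_complex_of_real of_real_mult[symmetric] by simp
qed

lemma amp_nonzero: "amp TYPE('n::finite) \<noteq> 0"
  using amp_normalization[where 'n = 'n] by auto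

text \<open>
  Two strictly increasing vectors that are permutations of each other are equal, and their entries
  are distinct.
\<close>

lemma weyl_chamber_permv:
  fixes m m' :: "int ^ 'n::{finite,linorder}"
  assumes m: "m \<in> weyl_chamber" "m' \<in> weyl_chamber" and p: "p permutes UNIV" and eq: "m = permv p m'"
  shows "p = id"
proof -
  have mono: "mono (\<lambda>k. n $ k)" if "n \<in> weyl_chamber" for n :: "int ^ 'n::{finite,linorder}"
    using that by (intro monoI) (auto simp: weyl_chamber_def le_less)
  have "(\<lambda>k. m' $ k) \<circ> p = (\<lambda>k. m' $ k)"
    using mono[OF m(1)] mono[OF m(2)] unfolding eq by (intro mono_rearrangement_unique[OF p]) (simp_all add: o_def)
  moreover have "inj (\<lambda>k. m' $ k)"
    using m(2) by (intro strict_mono_on_imp_inj_on strict_monoI) (auto simp: weyl_chamber_def)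
  ultimately show ?thesis by (auto simp: fun_eq_iff inj_def)
qed

text \<open>
  Writing out the first determinant and using the antisymmetry of the second shows that
  \<open>Psi_m m * cnj (Psi_m m')\<close> is the sum over all permutations of one function
  \<open>g\<close>. Hence the integral over \<open>config\<close> is that of \<open>g\<close> over
  the whole box, where expanding the second determinant leaves orthogonality of plane waves. Only
  the identity permutation can match two increasing frequencies.
\<close>

theorem Psi_m_orthonormal:
  fixes m m' :: "int ^ 'n::{finite,linorder}"
  assumes m: "m \<in> weyl_chamber" "m' \<in> weyl_chamber"
  shows "(\<integral>x. indicator config x *\<^sub>R (Psi_m m x * cnj (Psi_m m' x)) \<partial>lborel) = (if m = m' then 1 else 0)"
proof -
  let ?S = "{p. p permutes (UNIV :: 'n set)}"
  let ?a = "amp TYPE('n)"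
  let ?N = "complex_of_real ((2 * pi) ^ CARD('n))"
  define g where "g y = ?a * twist y * wave m y * cnj (Psi_m m' y)" for y
  have cont: "continuous_on UNIV g"
    unfolding g_def[abs_def]
    by (intro continuous_intros continuous_on_twist continuous_on_wave continuous_on_Psi_m)
  have [measurable]: "g \<in> borel_measurable borel" by (rule borel_measurable_continuous_onI[OF cont])
  have sum: "(\<Sum>p\<in>?S. g (permv p x)) = Psi_m m x * cnj (Psi_m m' x)" for x
  proof -
    have "g (permv p x) = ?a * twist x * (of_int (sign p) * wave m (permv p x)) * cnj (Psi_m m' x)"
      if "p \<in> ?S" for p
      using that by (simp add: g_def twist_permv Psi_m_permv_right)
    then show ?thesis by (simp add: Psi_m_eq[of m] sum_distrib_left sum_distrib_right mult.assoc)
  qed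
  have "(\<integral>x. indicator config x *\<^sub>R (Psi_m m x * cnj (Psi_m m' x)) \<partial>lborel)
      = (\<integral>x. indicator period_box x *\<^sub>R g x \<partial>lborel)"
    using integral_period_box_unfold(2)[OF _ integrable_period_box_continuous[OF cont]] by (simp add: sum)
  also have "\<dots> = (\<integral>x. (\<Sum>q\<in>?S. (?a * cnj ?a * of_int (sign q)) * (indicator period_box x *\<^sub>R wave (m - permv (inv q) m') x)) \<partial>lborel)"
  proof (rule Bochner_Integration.integral_cong[OF refl])
    fix x :: "real ^ 'n::{finite,linorder}"
    have "cnj (wave m' (permv q x)) = wave (- permv (inv q) m') x" if "q \<in> ?S" for q
    proof -
      have q: "q permutes UNIV" using that by simp
      have "wave m' (permv q x) = wave (permv q (permv (inv q) m')) (permv q x)"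
        by (simp add: permv_inverse[OF q])
      then show ?thesis by (simp add: wave_permv[OF q] cnj_wave)
    qed
    moreover have "twist x * cnj (twist x) = 1"
      by (simp flip: complex_norm_square)
    moreover have "g x = ?a * cnj ?a * (twist x * cnj (twist x)) * (wave m x * (\<Sum>q\<in>?S. of_int (sign q) * cnj (wave m' (permv q x))))"
      by (simp add: g_def Psi_m_eq[of m'] mult_ac)
    ultimately have "g x = (\<Sum>q\<in>?S. (?a * cnj ?a * of_int (sign q)) * (wave m x * wave (- permv (inv q) m') x))"
      by (simp add: sum_distrib_left mult_ac)
    also have "\<dots> = (\<Sum>q\<in>?S. (?a * cnj ?a * of_int (sign q)) * wave (m - permv (inv q) m') x)"
      by (simp flip: wave_add)
    finally show "indicator period_box x *\<^sub>R g x = (\<Sum>q\<in>?S. (?a * cnj ?a * of_int (sign q)) * (indicator period_box x *\<^sub>R wave (m - permv (inv q) m') x))"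
      by (simp add: scaleR_sum_right)
  qed
  also have "\<dots> = (\<Sum>q\<in>?S. (?a * cnj ?a * of_int (sign q)) * (\<integral>x. indicator period_box x *\<^sub>R wave (m - permv (inv q) m') x \<partial>lborel))"
    by (subst Bochner_Integration.integral_sum;
        (intro integrable_mult_right integrable_period_box_continuous continuous_on_wave)?)
       (simp only: integral_mult_right_zero)
  also have "\<dots> = (\<Sum>q\<in>?S. if q = id then (if m = m' then 1 else 0) else 0)"
  proof (rule sum.cong[OF refl])
    fix q assume "q \<in> ?S"
    then have q: "q permutes (UNIV :: 'n set)" by simp
    have "q = id" if "m = permv (inv q) m'"
    proof -
      have "inv q = id" by (rule weyl_chamber_permv[OF m permutes_inv[OF q] that])
      then show ?thesis by (metis inv_id permutes_inv_inv[OF q])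
    qed
    then show "(?a * cnj ?a * of_int (sign q)) * (\<integral>x. indicator period_box x *\<^sub>R wave (m - permv (inv q) m') x \<partial>lborel)
        = (if q = id then (if m = m' then 1 else 0) else 0)"
      using amp_normalization[where 'n = 'n] by (auto simp: integral_wave sign_id inv_id)
  qed
  also have "\<dots> = (if m = m' then 1 else 0)"
    by (simp add: permutes_id)
  finally show ?thesis .
qed

section \<open>Approximation in the mean on the period box\<close>

lemma norm_diff_square_le:
  fixes a b c :: "'a::real_normed_vector"
  shows "(norm (a - c))\<^sup>2 \<le> 2 * (norm (a - b))\<^sup>2 + 2 * (norm (b - c))\<^sup>2"
proof -
  have "norm (a - c) \<le> norm (a - b) + norm (b - c)"
    using norm_triangle_ineq[of "a - b" "b - c"] by simp
  then have "(norm (a - c))\<^sup>2 \<le> (norm (a - b) + norm (b - c))\<^sup>2"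
    by (intro power_mono) auto
  also have "\<dots> \<le> 2 * (norm (a - b))\<^sup>2 + 2 * (norm (b - c))\<^sup>2"
    using sum_squares_bound[of "norm (a - b)" "norm (b - c)"] by (simp add: power2_sum)
  finally show ?thesis .
qed

lemma integrable_le_nonneg:
  fixes f w :: "'a \<Rightarrow> real"
  assumes w: "integrable M w" and f: "f \<in> borel_measurable M" and le: "\<And>x. 0 \<le> f x" "\<And>x. f x \<le> w x"
  shows "integrable M f"
proof (rule Bochner_Integration.integrable_bound[OF w f])
  have "norm (f x) \<le> norm (w x)" for x
    using le(1)[of x] le(2)[of x] by simp
  then show "AE x in M. norm (f x) \<le> norm (w x)" by simp
qed

lemma L2_distance_combine:
  fixes a b c :: "real ^ 'n \<Rightarrow> complex"
  assumes [measurable]: "a \<in> borel_measurable borel" "c \<in> borel_measurable borel" "A \<in> sets borel"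
    and ab: "integrable lborel (\<lambda>x. indicator A x *\<^sub>R (norm (a x - b x))\<^sup>2)"
      "(\<integral>x. indicator A x *\<^sub>R (norm (a x - b x))\<^sup>2 \<partial>lborel) < e / 4"
    and bc: "integrable lborel (\<lambda>x. indicator A x *\<^sub>R (norm (b x - c x))\<^sup>2)"
      "(\<integral>x. indicator A x *\<^sub>R (norm (b x - c x))\<^sup>2 \<partial>lborel) < e / 4"
  shows "integrable lborel (\<lambda>x. indicator A x *\<^sub>R (norm (a x - c x))\<^sup>2)"
    and "(\<integral>x. indicator A x *\<^sub>R (norm (a x - c x))\<^sup>2 \<partial>lborel) < e"
proof -
  let ?w = "\<lambda>x. 2 * (indicator A x *\<^sub>R (norm (a x - b x))\<^sup>2) + 2 * (indicator A x *\<^sub>R (norm (b x - c x))\<^sup>2)"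
  have w: "integrable lborel ?w" using ab bc by simp
  have le: "indicator A x *\<^sub>R (norm (a x - c x))\<^sup>2 \<le> ?w x" for x
    using norm_diff_square_le[of "a x" "c x" "b x"] by (simp add: indicator_def)
  show int: "integrable lborel (\<lambda>x. indicator A x *\<^sub>R (norm (a x - c x))\<^sup>2)"
    by (rule integrable_le_nonneg[OF w]) (use le in auto)
  have "(\<integral>x. indicator A x *\<^sub>R (norm (a x - c x))\<^sup>2 \<partial>lborel) \<le> integral\<^sup>L lborel ?w"
    by (rule integral_mono[OF int w le])
  also have "\<dots> = 2 * (\<integral>x. indicator A x *\<^sub>R (norm (a x - b x))\<^sup>2 \<partial>lborel) + 2 * (\<integral>x. indicator A x *\<^sub>R (norm (b x - c x))\<^sup>2 \<partial>lborel)"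
    using ab(1) bc(1) by (subst Bochner_Integration.integral_add) auto
  also have "\<dots> < e" using ab(2) bc(2) by simp
  finally show "(\<integral>x. indicator A x *\<^sub>R (norm (a x - c x))\<^sup>2 \<partial>lborel) < e" .
qed

text \<open>
  Vanishes on the faces of the box and tends to \<open>1\<close> inside. Multiplying by it makes a
  continuous function respect the identification of opposite faces.
\<close>

definition edge_cutoff :: "nat \<Rightarrow> real ^ 'n \<Rightarrow> real" where
  "edge_cutoff k x = (\<Prod>i\<in>UNIV. min 1 (real k * (x $ i * (2 * pi - x $ i))))"

lemma edge_cutoff_bounds:
  assumes "x \<in> period_box" shows "0 \<le> edge_cutoff k x" "edge_cutoff k x \<le> 1"
proof -
  have "0 \<le> x $ i * (2 * pi - x $ i)" for i
    using assms by (auto simp: mem_period_box)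
  then have "0 \<le> min 1 (real k * (x $ i * (2 * pi - x $ i)))" for i by simp
  then show "0 \<le> edge_cutoff k x" "edge_cutoff k x \<le> 1"
    unfolding edge_cutoff_def by (auto intro!: prod_nonneg prod_le_1)
qed

lemma edge_cutoff_edge:
  assumes "x $ i = 0 \<or> x $ i = 2 * pi" shows "edge_cutoff k x = 0"
  unfolding edge_cutoff_def by (intro prod_zero bexI[of _ i]) (use assms in auto)

lemma edge_cutoff_tendsto:
  fixes x :: "real ^ 'n"
  assumes "\<And>i. 0 < x $ i \<and> x $ i < 2 * pi"
  shows "(\<lambda>k. edge_cutoff k x) \<longlonglongrightarrow> 1"
proof -
  have "(\<lambda>k. min 1 (real k * (x $ i * (2 * pi - x $ i)))) \<longlonglongrightarrow> 1" for i
  proof (rule tendsto_eventually)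
    let ?c = "x $ i * (2 * pi - x $ i)"
    have c: "?c > 0" using assms[of i] by simp
    have "eventually (\<lambda>k. real k \<ge> 1 / ?c) sequentially"
      using filterlim_real_sequentially unfolding filterlim_at_top by blast
    then show "eventually (\<lambda>k. min 1 (real k * ?c) = 1) sequentially"
      by eventually_elim (use c in \<open>simp add: field_simps min_def\<close>)
  qed
  then have "(\<lambda>k. edge_cutoff k x) \<longlonglongrightarrow> (\<Prod>i\<in>(UNIV :: 'n set). 1)"
    unfolding edge_cutoff_def by (intro tendsto_prod)
  then show ?thesis by simp
qed

lemma continuous_on_edge_cutoff: "continuous_on S (edge_cutoff k)"
  unfolding edge_cutoff_def[abs_def] by (intro continuous_intros)

text \<open>
  Some coordinate differs by a nonzero multiple of \<open>2\<pi>\<close>, and the box has room for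
  that only between two opposite faces.
\<close>

lemma torus_eq_period_boxD:
  fixes x y :: "real ^ 'n"
  assumes "x \<in> period_box" "y \<in> period_box" "torus x = torus y" "x \<noteq> y"
  obtains i where "x $ i = 0 \<or> x $ i = 2 * pi" "y $ i = 0 \<or> y $ i = 2 * pi"
proof -
  obtain n :: "int ^ 'n" where n: "x = y + (\<chi> i. 2 * pi * of_int (n $ i))"
    using torus_eqD[OF assms(3)] .
  with \<open>x \<noteq> y\<close> obtain i where i: "n $ i \<noteq> 0" by (auto simp: vec_eq_iff)
  have xy: "x $ i = y $ i + 2 * pi * of_int (n $ i)" using n by simp
  have b: "0 \<le> x $ i" "x $ i \<le> 2 * pi" "0 \<le> y $ i" "y $ i \<le> 2 * pi"
    using assms(1,2) by (auto simp: mem_period_box)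
  consider "n $ i \<ge> 1" | "n $ i \<le> -1" using i by linarith
  then have "(x $ i = 0 \<or> x $ i = 2 * pi) \<and> (y $ i = 0 \<or> y $ i = 2 * pi)"
  proof cases
    case 1
    then have "2 * pi * of_int (n $ i) \<ge> 2 * pi * 1" by (intro mult_left_mono) auto
    then show ?thesis using xy b by linarith
  next
    case 2
    then have "2 * pi * of_int (n $ i) \<le> 2 * pi * (-1)" by (intro mult_left_mono) auto
    then show ?thesis using xy b by linarith
  qed
  then show ?thesis using that by blast
qed

text \<open>
  A measurable function is the almost everywhere limit of continuous ones; projecting onto the
  ball of radius \<open>B\<close> keeps them bounded without destroying convergence.
\<close>

lemma continuous_approximants:
  fixes h :: "real ^ 'n \<Rightarrow> complex"
  assumes [measurable]: "h \<in> borel_measurable borel" and B: "\<And>x. norm (h x) \<le> B"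
  shows "\<exists>g. (\<forall>k. continuous_on UNIV (g k)) \<and> (\<forall>k x. norm (g k x :: complex) \<le> B) \<and>
    (AE x in lborel. (\<lambda>k. g k x) \<longlonglongrightarrow> h x)"
proof -
  have "h \<in> borel_measurable lebesgue" by (intro measurable_completion) simp
  then have "h measurable_on UNIV"
    by (simp add: measurable_on_iff_borel_measurable lebesgue_on_UNIV_eq)
  then obtain N f where N: "negligible N" and f: "\<And>k. continuous_on UNIV (f k)"
    "\<And>x. x \<notin> N \<Longrightarrow> (\<lambda>k. f k x) \<longlonglongrightarrow> h x"
    unfolding measurable_on_def by auto
  let ?c = "closest_point (cball (0 :: complex) B)"
  have "0 \<le> B" using B[of 0] norm_ge_zero order_trans by blast
  then have ball: "convex (cball (0 :: complex) B)" "closed (cball (0 :: complex) B)" "cball (0 :: complex) B \<noteq> {}"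
    by auto
  have c: "continuous_on S ?c" for S by (rule continuous_on_closest_point[OF ball])
  have "continuous_on UNIV (\<lambda>x. ?c (f k x))" for k
    by (rule continuous_on_compose2[OF c f(1)]) auto
  moreover have "norm (?c (f k x)) \<le> B" for k x
    using closest_point_in_set[OF ball(2,3), of "f k x"] by simp
  moreover have "AE x in lborel. (\<lambda>k. ?c (f k x)) \<longlonglongrightarrow> h x"
  proof -
    have "AE x in lebesgue. x \<notin> N"
      using N by (simp add: AE_not_in negligible_iff_null_sets)
    then have "AE x in lborel. x \<notin> N" by (simp add: AE_completion_iff)
    then show ?thesis
    proof eventually_elim
      case (elim x)
      have "(\<lambda>k. ?c (f k x)) \<longlonglongrightarrow> ?c (h x)"
        by (rule continuous_on_tendsto_compose[OF c[of UNIV] f(2)[OF elim]]) auto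
      then show ?case using closest_point_self[of "h x" "cball 0 B"] B[of x] by simp
    qed
  qed
  ultimately show ?thesis by (intro exI[of _ "\<lambda>k x. ?c (f k x)"]) simp
qed

text \<open>
  The continuous approximants, cut off at the faces of the box, converge in the mean by dominated
  convergence, and each of them is a uniform limit of trigonometric polynomials.
\<close>

lemma bounded_L2_trigonometric_approximation:
  fixes h :: "real ^ 'n \<Rightarrow> complex"
  assumes [measurable]: "h \<in> borel_measurable borel" and B: "\<And>x. norm (h x) \<le> B" and e: "e > 0"
  shows "\<exists>T\<in>lin_span (range wave).
    integrable lborel (\<lambda>x. indicator period_box x *\<^sub>R (norm (h x - T x))\<^sup>2) \<and>
    (\<integral>x. indicator period_box x *\<^sub>R (norm (h x - T x))\<^sup>2 \<partial>lborel) < e"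
proof -
  obtain g where g: "\<And>k. continuous_on UNIV (g k)" "\<And>k x. norm (g k x :: complex) \<le> B"
    "AE x in lborel. (\<lambda>k. g k x) \<longlonglongrightarrow> h x"
    using continuous_approximants[OF assms(1) B] by blast
  define u where "u k x = of_real (edge_cutoff k x) * g k x" for k x
  have u: "continuous_on S (u k)" for k S
    unfolding u_def by (intro continuous_intros continuous_on_edge_cutoff continuous_on_subset[OF g(1)] subset_UNIV)
  then have [measurable]: "u k \<in> borel_measurable borel" for k by (rule borel_measurable_continuous_onI)
  let ?D = "\<lambda>k x. indicator period_box x *\<^sub>R (norm (h x - u k x))\<^sup>2 :: real"
  let ?w = "\<lambda>x. indicator period_box x *\<^sub>R (2 * B)\<^sup>2 :: real"
  have w: "integrable lborel ?w" by (rule integrable_period_box_continuous) (rule continuous_on_const)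
  have bound: "norm (?D k x) \<le> ?w x" for k x
  proof (cases "x \<in> period_box")
    case True
    have "norm (u k x) \<le> 1 * B"
      unfolding u_def norm_mult using edge_cutoff_bounds[OF True, of k] g(2)[of k x]
      by (intro mult_mono) auto
    then have "norm (h x - u k x) \<le> 2 * B"
      using B[of x] norm_triangle_ineq4[of "h x" "u k x"] by simp
    then have "(norm (h x - u k x))\<^sup>2 \<le> (2 * B)\<^sup>2" by (intro power_mono) auto
    then show ?thesis using True by simp
  qed simp
  have "(\<lambda>k. integral\<^sup>L lborel (?D k)) \<longlonglongrightarrow> integral\<^sup>L lborel (\<lambda>x :: real ^ 'n. 0 :: real)"
  proof (rule integral_dominated_convergence[OF _ _ w])
    have "AE x :: real ^ 'n in lborel. \<forall>i. x $ i \<noteq> 0" "AE x :: real ^ 'n in lborel. \<forall>i. x $ i \<noteq> 2 * pi"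
      by (simp_all add: AE_all_countable AE_coord_neq)
    then show "AE x in lborel. (\<lambda>k. ?D k x) \<longlonglongrightarrow> 0"
      using g(3)
    proof eventually_elim
      case (elim x)
      show ?case
      proof (cases "x \<in> period_box")
        case True
        then have "0 < x $ i \<and> x $ i < 2 * pi" for i
          using elim by (auto simp: mem_period_box order_less_le)
        from edge_cutoff_tendsto[OF this] have "(\<lambda>k. u k x) \<longlonglongrightarrow> of_real 1 * h x"
          unfolding u_def by (intro tendsto_mult tendsto_of_real elim)
        then have "(\<lambda>k. (norm (h x - u k x))\<^sup>2) \<longlonglongrightarrow> (norm (h x - of_real 1 * h x))\<^sup>2"
          by (intro tendsto_intros)
        then show ?thesis using True by simp
      qed simp
    qed
    show "AE x in lborel. norm (?D k x) \<le> ?w x" for k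
      using bound by simp
  qed measurable
  then have "eventually (\<lambda>k. integral\<^sup>L lborel (?D k) < e / 4) sequentially"
    using e by (intro order_tendstoD(2)) auto
  then obtain k where k: "integral\<^sup>L lborel (?D k) < e / 4"
    by (auto simp: eventually_sequentially)
  have Dk: "integrable lborel (?D k)"
    by (rule Bochner_Integration.integrable_bound[OF w]) (use bound in \<open>auto simp: order_trans[OF _ abs_ge_self]\<close>)
  define C where "C = measure lborel (period_box :: (real ^ 'n) set)"
  \<comment> \<open>Small enough that a uniform error \<open>d\<close> on a set of measure \<open>C\<close> has
    mean square below \<open>e / 4\<close>.\<close>
  define d where "d = sqrt (e / (8 * (C + 1)))"
  have C: "C \<ge> 0" by (simp add: C_def)
  have d: "d > 0" using e C by (simp add: d_def)
  have d2: "d\<^sup>2 = e / (8 * (C + 1))" using e C by (simp add: d_def)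
  have glue: "u k x = u k y" if xy: "x \<in> period_box" "y \<in> period_box" "torus x = torus y" for x y
  proof (cases "x = y")
    case False
    obtain i where "x $ i = 0 \<or> x $ i = 2 * pi" "y $ i = 0 \<or> y $ i = 2 * pi"
      using torus_eq_period_boxD[OF xy False] .
    then show ?thesis using edge_cutoff_edge unfolding u_def by (metis mult_zero_left of_real_0)
  qed simp
  obtain T where T: "T \<in> lin_span (range wave)" "\<And>x. x \<in> period_box \<Longrightarrow> norm (u k x - T x) < d"
    by (rule trigonometric_approximation[OF u glue d]) (auto intro: that)
  have [measurable]: "T \<in> borel_measurable borel" by (rule measurable_span_wave[OF T(1)])
  have uT: "continuous_on UNIV (\<lambda>x. (norm (u k x - T x))\<^sup>2)"
    by (intro continuous_intros u continuous_on_span_wave T(1))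
  have "(\<integral>x. indicator period_box x *\<^sub>R (norm (u k x - T x))\<^sup>2 \<partial>lborel) \<le> (\<integral>x. indicator (period_box :: (real ^ 'n) set) x *\<^sub>R d\<^sup>2 \<partial>lborel)"
    by (intro integral_mono integrable_period_box_continuous uT continuous_on_const)
       (auto simp: indicator_def intro!: power_mono order.strict_implies_order[OF T(2)])
  also have "\<dots> = C * d\<^sup>2"
    by (simp add: C_def)
  also have "\<dots> \<le> e / 8" using C e by (simp add: d2 field_simps)
  also have "\<dots> < e / 4" using e by simp
  finally have "(\<integral>x. indicator period_box x *\<^sub>R (norm (u k x - T x))\<^sup>2 \<partial>lborel) < e / 4" .
  from L2_distance_combine[OF _ _ _ Dk k integrable_period_box_continuous[OF uT] this]
  show ?thesis using T(1) by (intro bexI[OF _ T(1)] conjI) simp_all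
qed

text \<open>
  The truncations of \<open>h\<close> are bounded and converge to \<open>h\<close> in the mean,
  the squared error being dominated by \<open>\<bar>h\<bar>\<^sup>2\<close>.
\<close>

theorem L2_trigonometric_approximation:
  fixes h :: "real ^ 'n \<Rightarrow> complex"
  assumes [measurable]: "h \<in> borel_measurable borel"
    and h: "integrable lborel (\<lambda>x. indicator period_box x *\<^sub>R (norm (h x))\<^sup>2)" and e: "e > 0"
  shows "\<exists>T\<in>lin_span (range wave).
    integrable lborel (\<lambda>x. indicator period_box x *\<^sub>R (norm (h x - T x))\<^sup>2) \<and>
    (\<integral>x. indicator period_box x *\<^sub>R (norm (h x - T x))\<^sup>2 \<partial>lborel) < e"
proof -
  define t where "t k x = (if norm (h x) \<le> real k then h x else 0)" for k :: nat and x
  have [measurable]: "t k \<in> borel_measurable borel" for k unfolding t_def[abs_def] by measurable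
  let ?D = "\<lambda>k x. indicator period_box x *\<^sub>R (norm (h x - t k x))\<^sup>2 :: real"
  let ?w = "\<lambda>x. indicator period_box x *\<^sub>R (norm (h x))\<^sup>2 :: real"
  have bound: "norm (?D k x) \<le> ?w x" for k x by (simp add: t_def indicator_def)
  have "(\<lambda>k. integral\<^sup>L lborel (?D k)) \<longlonglongrightarrow> integral\<^sup>L lborel (\<lambda>x :: real ^ 'n. 0 :: real)"
  proof (rule integral_dominated_convergence[OF _ _ h])
    have "(\<lambda>k. ?D k x) \<longlonglongrightarrow> 0" for x
    proof (rule tendsto_eventually)
      have "eventually (\<lambda>k. real k \<ge> norm (h x)) sequentially"
        using filterlim_real_sequentially unfolding filterlim_at_top by blast
      then show "eventually (\<lambda>k. ?D k x = 0) sequentially"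
        by eventually_elim (simp add: t_def)
    qed
    then show "AE x in lborel. (\<lambda>k. ?D k x) \<longlonglongrightarrow> 0" by simp
    show "AE x in lborel. norm (?D k x) \<le> ?w x" for k
      using bound by simp
  qed measurable
  then have "eventually (\<lambda>k. integral\<^sup>L lborel (?D k) < e / 4) sequentially"
    using e by (intro order_tendstoD(2)) auto
  then obtain k where k: "integral\<^sup>L lborel (?D k) < e / 4"
    by (auto simp: eventually_sequentially)
  have Dk: "integrable lborel (?D k)"
    by (rule Bochner_Integration.integrable_bound[OF h]) (use bound in \<open>auto simp: order_trans[OF _ abs_ge_self]\<close>)
  have e4: "e / 4 > 0" using e by simp
  have tk: "norm (t k x) \<le> real k" for x by (simp add: t_def)
  have "t k \<in> borel_measurable borel" by measurable
  from bounded_L2_trigonometric_approximation[OF this tk e4]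
  obtain T where T: "T \<in> lin_span (range wave)"
    "integrable lborel (\<lambda>x. indicator period_box x *\<^sub>R (norm (t k x - T x))\<^sup>2)"
    "(\<integral>x. indicator period_box x *\<^sub>R (norm (t k x - T x))\<^sup>2 \<partial>lborel) < e / 4"
    by blast
  have [measurable]: "T \<in> borel_measurable borel" by (rule measurable_span_wave[OF T(1)])
  from L2_distance_combine[OF _ _ _ Dk k T(2,3)]
  show ?thesis by (intro bexI[OF _ T(1)] conjI) simp_all
qed

section \<open>Orthonormal bases and the uniform density\<close>

text \<open>
  Antisymmetrising a plane wave of any frequency gives a multiple of some \<open>Psi_m n\<close>.
\<close>

lemma antisymmetrize_in_span:
  fixes T :: "real ^ 'n::{finite,linorder} \<Rightarrow> complex"
  assumes "T \<in> lin_span (range wave)"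
  shows "(\<lambda>x. \<Sum>p | p permutes UNIV. of_int (sign p) * (twist x * T (permv p x))) \<in> lin_span (Psi_m ` weyl_chamber)"
  using assms
proof (induction rule: lin_span_induct)
  case zero
  then show ?case by (simp add: lin_span_zero)
next
  case (step b c g)
  then obtain n where b: "b = wave n" by blast
  let ?a = "amp TYPE('n)"
  have "(\<lambda>x. c / ?a * Psi_m n x + (\<Sum>p | p permutes UNIV. of_int (sign p) * (twist x * g (permv p x))))
      \<in> lin_span (Psi_m ` weyl_chamber)"
    by (intro lin_span_add lin_span_cmult Psi_m_in_span_weyl step)
  moreover have "(\<Sum>p | p permutes UNIV. of_int (sign p) * (twist x * (c * b (permv p x) + g (permv p x))))
      = c / ?a * Psi_m n x + (\<Sum>p | p permutes UNIV. of_int (sign p) * (twist x * g (permv p x)))" for x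
    using amp_nonzero[where 'n = 'n]
    by (simp add: b Psi_m_eq sum.distrib sum_distrib_left algebra_simps)
  ultimately show ?case by (simp only:)
qed

text \<open>
  Extend \<open>f\<close> by zero from \<open>config\<close> to the box, remove the twist, and
  take a trigonometric approximant \<open>T\<close> there. On \<open>config\<close> the extension
  is its own antisymmetrisation, since no other rearrangement of a configuration is one. So the
  error of the antisymmetrised \<open>T\<close> is the antisymmetrised error, and its square is at
  most \<open>N!\<close> times the sum of the squared errors at the rearranged points, whose
  integral over \<open>config\<close> unfolds to an integral over the box.
\<close>

theorem span_Psi_m_L2_dense:
  fixes f :: "real ^ 'n::{finite,linorder} \<Rightarrow> complex"
  assumes f_meas: "(\<lambda>x. indicator config x *\<^sub>R f x) \<in> borel_measurable borel"
    and f: "integrable lborel (\<lambda>x. indicator config x *\<^sub>R (norm (f x))\<^sup>2)" and e: "e > 0"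
  shows "\<exists>G\<in>lin_span (Psi_m ` weyl_chamber).
    (\<integral>x. indicator config x *\<^sub>R (norm (f x - G x))\<^sup>2 \<partial>lborel) < e"
proof -
  let ?S = "{p. p permutes (UNIV :: 'n set)}"
  define c where "c = real (card ?S)"
  have c: "c > 0"
    unfolding c_def by (auto simp: card_gt_0_iff intro: exI[of _ id] permutes_id)
  define f0 where "f0 x = indicator config x *\<^sub>R f x" for x
  have [measurable]: "f0 \<in> borel_measurable borel" using f_meas by (simp add: f0_def[abs_def])
  define h where "h x = cnj (twist x) * f0 x" for x
  have [measurable]: "(\<lambda>x :: real ^ 'n::{finite,linorder}. cnj (twist x)) \<in> borel_measurable borel"
    by (intro borel_measurable_continuous_onI continuous_intros continuous_on_twist)
  have [measurable]: "h \<in> borel_measurable borel" unfolding h_def[abs_def] by measurable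
  have "indicator period_box x *\<^sub>R (norm (h x))\<^sup>2 = indicator config x *\<^sub>R (norm (f x))\<^sup>2" for x
    using config_subset_period_box by (auto simp: h_def f0_def norm_mult indicator_def)
  then have h: "integrable lborel (\<lambda>x. indicator period_box x *\<^sub>R (norm (h x))\<^sup>2)"
    using f by simp
  have "e / c > 0" using e c by simp
  from L2_trigonometric_approximation[OF _ h this]
  obtain T where T: "T \<in> lin_span (range wave)"
    "integrable lborel (\<lambda>x. indicator period_box x *\<^sub>R (norm (h x - T x))\<^sup>2)"
    "(\<integral>x. indicator period_box x *\<^sub>R (norm (h x - T x))\<^sup>2 \<partial>lborel) < e / c"
    by auto
  have [measurable]: "T \<in> borel_measurable borel" by (rule measurable_span_wave[OF T(1)])
  let ?n = "\<lambda>x. (norm (h x - T x))\<^sup>2"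
  note unfold = integral_period_box_unfold[OF _ T(2)]
  define G where "G x = (\<Sum>p\<in>?S. of_int (sign p) * (twist x * T (permv p x)))" for x
  have G: "G \<in> lin_span (Psi_m ` weyl_chamber)"
    unfolding G_def[abs_def] by (rule antisymmetrize_in_span[OF T(1)])
  have [measurable]: "G \<in> borel_measurable borel" unfolding G_def[abs_def] by measurable
  have pt: "(norm (f x - G x))\<^sup>2 \<le> c * (\<Sum>p\<in>?S. ?n (permv p x))" if x: "x \<in> config" for x
  proof -
    \<comment> \<open>A configuration is the only one among its rearrangements.\<close>
    have "f0 (permv p x) = (if p = id then f x else 0)" if "p \<in> ?S" for p
      using config_permv_unique[OF permutes_id, of p x] that x by (auto simp: f0_def indicator_def)
    then have "(\<Sum>p\<in>?S. of_int (sign p) * f0 (permv p x)) = (\<Sum>p\<in>?S. if p = id then f x else 0)"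
      by (intro sum.cong refl) (simp add: sign_id)
    also have "\<dots> = f x" by (simp add: permutes_id)
    finally have fx: "f x = (\<Sum>p\<in>?S. of_int (sign p) * f0 (permv p x))" ..
    have "f0 (permv p x) = twist x * h (permv p x)" if "p \<in> ?S" for p
    proof -
      have "twist x * cnj (twist x) = 1" by (simp flip: complex_norm_square)
      then have "twist x * (cnj (twist x) * f0 (permv p x)) = f0 (permv p x)"
        by (simp add: mult.assoc[symmetric])
      then show ?thesis using that by (simp add: h_def twist_permv)
    qed
    then have "f x - G x = (\<Sum>p\<in>?S. of_int (sign p) * (twist x * (h (permv p x) - T (permv p x))))"
      unfolding G_def fx by (simp add: sum_subtractf algebra_simps)
    then have "norm (f x - G x) \<le> (\<Sum>p\<in>?S. norm (h (permv p x) - T (permv p x)))"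
      by (auto intro!: order_trans[OF norm_sum] sum_mono simp: norm_mult sign_def)
    then have "(norm (f x - G x))\<^sup>2 \<le> (\<Sum>p\<in>?S. norm (h (permv p x) - T (permv p x)))\<^sup>2"
      by (intro power_mono) auto
    also have "\<dots> \<le> (\<Sum>p\<in>?S. ?n (permv p x)) * c"
      unfolding c_def by (rule sum_squared_le_sum_of_squares)
    finally show ?thesis by (simp add: mult.commute)
  qed
  let ?w = "\<lambda>x. c * (indicator config x *\<^sub>R (\<Sum>p\<in>?S. ?n (permv p x)))"
  have w: "integrable lborel ?w" using unfold(1) by (intro integrable_mult_right) simp
  have le: "indicator config x *\<^sub>R (norm (f x - G x))\<^sup>2 \<le> ?w x" for x
    using pt[of x] by (simp add: indicator_def)
  have eq: "indicator config x *\<^sub>R (norm (f x - G x))\<^sup>2 = indicator config x *\<^sub>R (norm (f0 x - G x))\<^sup>2" for x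
    by (simp add: f0_def indicator_def)
  have int: "integrable lborel (\<lambda>x. indicator config x *\<^sub>R (norm (f x - G x))\<^sup>2)"
  proof (rule integrable_le_nonneg[OF w _ _ le])
    show "(\<lambda>x. indicator config x *\<^sub>R (norm (f x - G x))\<^sup>2) \<in> borel_measurable lborel"
      unfolding eq by measurable
  qed simp
  have "(\<integral>x. indicator config x *\<^sub>R (norm (f x - G x))\<^sup>2 \<partial>lborel) \<le> integral\<^sup>L lborel ?w"
    by (rule integral_mono[OF int w le])
  also have "\<dots> = c * (\<integral>x. indicator config x *\<^sub>R (\<Sum>p\<in>?S. ?n (permv p x)) \<partial>lborel)"
    by (rule integral_mult_right_zero)
  also have "\<dots> = c * (\<integral>x. indicator period_box x *\<^sub>R ?n x \<partial>lborel)"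
    using unfold(2) by simp
  also have "\<dots> < e" using T(3) c by (simp add: field_simps)
  finally show ?thesis using G by blast
qed

lemma restrict_mu:
  "restrict_space mu config =
     density (restrict_space lborel config) (\<lambda>x :: real ^ 'n::{finite,linorder}. ennreal ((norm (Psi_m ground x))\<^sup>2))"
proof (rule measure_eqI)
  have w: "ennreal ((Psi x)\<^sup>2) = ennreal ((norm (Psi_m ground x))\<^sup>2)" for x :: "real ^ 'n::{finite,linorder}"
    by (simp add: norm_Psi_m_ground)
  show "sets (restrict_space mu config) = sets (density (restrict_space lborel config) (\<lambda>x :: real ^ 'n::{finite,linorder}. ennreal ((norm (Psi_m ground x))\<^sup>2)))"
    by (simp add: mu_def sets_restrict_space)
  fix A :: "(real ^ 'n::{finite,linorder}) set"
  assume "A \<in> sets (restrict_space mu config)"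
  then have A: "A \<subseteq> config" "A \<in> sets borel"
    by (auto simp: sets_restrict_space mu_def)
  have Ar: "A \<in> sets (restrict_space lborel config)"
    using A by (auto simp: sets_restrict_space image_iff)
  have "emeasure (restrict_space mu config) A = emeasure mu A"
    using A by (intro emeasure_restrict_space) (auto simp: mu_def)
  also have "\<dots> = (\<integral>\<^sup>+x. ennreal ((norm (Psi_m ground x))\<^sup>2) * indicator config x * indicator A x \<partial>lborel)"
    unfolding mu_def w using A by (subst emeasure_density) auto
  also have "\<dots> = (\<integral>\<^sup>+x. ennreal ((norm (Psi_m ground x))\<^sup>2) * indicator A x * indicator config x \<partial>lborel)"
    by (simp add: mult_ac)
  also have "\<dots> = (\<integral>\<^sup>+x. ennreal ((norm (Psi_m ground x))\<^sup>2) * indicator A x \<partial>restrict_space lborel config)"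
    by (subst nn_integral_restrict_space) auto
  also have "\<dots> = emeasure (density (restrict_space lborel config) (\<lambda>x. ennreal ((norm (Psi_m ground x))\<^sup>2))) A"
    using Ar by (subst emeasure_density) (auto intro!: measurable_restrict_space1)
  finally show "emeasure (restrict_space mu config) A = emeasure (density (restrict_space lborel config) (\<lambda>x. ennreal ((norm (Psi_m ground x))\<^sup>2))) A" .
qed

theorem orthonormal_basis_Psi_m:
  "orthonormal_basis (restrict_space lborel config)
     (weyl_chamber :: (int ^ 'n::{finite,linorder}) set) Psi_m"
  unfolding orthonormal_basis_def
proof (intro conjI ballI allI impI)
  let ?M = "restrict_space lborel (config :: (real ^ 'n::{finite,linorder}) set)"
  have config: "config \<inter> space lborel \<in> sets (lborel :: (real ^ 'n::{finite,linorder}) measure)"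
    by simp
  fix m :: "int ^ 'n::{finite,linorder}" assume m: "m \<in> weyl_chamber"
  have "integrable ?M (\<lambda>x. (norm (Psi_m m x))\<^sup>2)"
    unfolding integrable_restrict_space[OF config]
    by (intro integrable_config_continuous continuous_intros continuous_on_Psi_m)
  then show "Psi_m m \<in> L2 ?M"
    unfolding L2_def by (auto intro: measurable_restrict_space1)
  fix m' :: "int ^ 'n::{finite,linorder}" assume m': "m' \<in> weyl_chamber"
  show "L2_inner ?M (Psi_m m) (Psi_m m') = (if m = m' then 1 else 0)"
    unfolding L2_inner_def integral_restrict_space[OF config] by (rule Psi_m_orthonormal[OF m m'])
next
  let ?M = "restrict_space lborel (config :: (real ^ 'n::{finite,linorder}) set)"
  have config: "config \<inter> space lborel \<in> sets (lborel :: (real ^ 'n::{finite,linorder}) measure)"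
    by simp
  fix f :: "real ^ 'n::{finite,linorder} \<Rightarrow> complex" and e :: real
  assume f: "f \<in> L2 ?M" and e: "0 < e"
  have "(\<lambda>x. indicator config x *\<^sub>R f x) \<in> borel_measurable borel"
    using f borel_measurable_restrict_space_iff[OF config, of f] by (simp add: L2_def)
  moreover have "integrable lborel (\<lambda>x. indicator config x *\<^sub>R (norm (f x))\<^sup>2)"
    using f unfolding L2_def integrable_restrict_space[OF config] by simp
  moreover have "0 < e\<^sup>2" using e by simp
  ultimately obtain G where G: "G \<in> lin_span (Psi_m ` weyl_chamber)"
    "(\<integral>x. indicator config x *\<^sub>R (norm (f x - G x))\<^sup>2 \<partial>lborel) < e\<^sup>2"
    using span_Psi_m_L2_dense by blast
  have "L2_norm ?M (\<lambda>x. f x - G x) < e"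
    unfolding L2_norm_def integral_restrict_space[OF config]
    using G(2) e real_sqrt_less_mono[OF G(2)] by simp
  then show "\<exists>g\<in>lin_span (Psi_m ` weyl_chamber). L2_norm ?M (\<lambda>x. f x - g x) < e"
    using G(1) by blast
qed

text \<open>
  Multiplication by \<open>Psi_m ground\<close> is an isometry from \<open>L2\<close> of
  \<open>mu\<close> into \<open>L2\<close> of Lebesgue measure, and it maps \<open>S_fun m\<close>
  to \<open>Psi_m m\<close>.
\<close>

theorem orthonormal_basis_S_fun:
  "orthonormal_basis (restrict_space mu config)
     (weyl_chamber :: (int ^ 'n::{finite,linorder}) set) S_fun"
proof -
  let ?M = "restrict_space lborel (config :: (real ^ 'n::{finite,linorder}) set)"
  define w where "w x = (norm (Psi_m ground x))\<^sup>2" for x :: "real ^ 'n::{finite,linorder}"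
  have mu: "restrict_space mu config = density ?M (\<lambda>x. ennreal (w x))"
    unfolding restrict_mu w_def ..
  have w: "w \<in> borel_measurable ?M" "AE x in ?M. 0 \<le> w x"
    unfolding w_def[abs_def] by (auto intro!: measurable_restrict_space1)
  have basis: "orthonormal_basis ?M weyl_chamber Psi_m" by (rule orthonormal_basis_Psi_m)
  have cont: "continuous_on A (S_fun m)" for A and m :: "int ^ 'n::{finite,linorder}"
    by (intro continuous_on_span_wave S_fun_in_span_wave)
  then have [measurable]: "S_fun m \<in> borel_measurable borel" for m :: "int ^ 'n::{finite,linorder}"
    by (rule borel_measurable_continuous_onI)
  have S_meas: "g \<in> borel_measurable ?M" if "g \<in> lin_span S_set" for g :: "real ^ 'n::{finite,linorder} \<Rightarrow> complex"
    using measurable_span_wave[OF subsetD[OF span_S_set_subset that]]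
    by (intro measurable_restrict_space1) simp
  have sq: "w x *\<^sub>R (norm (g x))\<^sup>2 = (norm (g x * Psi_m ground x))\<^sup>2" for g :: "_ \<Rightarrow> complex" and x
    by (simp add: w_def norm_mult power_mult_distrib)
  show ?thesis
    unfolding orthonormal_basis_def mu
  proof (intro conjI ballI allI impI)
    fix m :: "int ^ 'n::{finite,linorder}" assume m: "m \<in> weyl_chamber"
    have Sm: "S_fun m \<in> borel_measurable ?M"
      by (intro measurable_restrict_space1) simp
    have "integrable ?M (\<lambda>x. w x *\<^sub>R (norm (S_fun m x))\<^sup>2)"
      using basis m unfolding sq S_fun_times_Psi_m_ground by (simp add: orthonormal_basis_def L2_def)
    then show "S_fun m \<in> L2 (density ?M (\<lambda>x. ennreal (w x)))"
      unfolding L2_def using Sm w by (simp add: integrable_density)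
    fix m' :: "int ^ 'n::{finite,linorder}" assume m': "m' \<in> weyl_chamber"
    have "(\<lambda>x. S_fun m x * cnj (S_fun m' x)) \<in> borel_measurable borel"
      by (intro borel_measurable_continuous_onI continuous_intros cont)
    then have SS: "(\<lambda>x. S_fun m x * cnj (S_fun m' x)) \<in> borel_measurable ?M"
      by (intro measurable_restrict_space1) simp
    have "L2_inner (density ?M (\<lambda>x. ennreal (w x))) (S_fun m) (S_fun m')
        = (\<integral>x. w x *\<^sub>R (S_fun m x * cnj (S_fun m' x)) \<partial>?M)"
      unfolding L2_inner_def using w SS by (intro integral_density)
    also have "\<dots> = L2_inner ?M (Psi_m m) (Psi_m m')"
      unfolding L2_inner_def
    proof (rule Bochner_Integration.integral_cong[OF refl])
      fix x
      show "w x *\<^sub>R (S_fun m x * cnj (S_fun m' x)) = Psi_m m x * cnj (Psi_m m' x)"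
        unfolding S_fun_times_Psi_m_ground[of m x, symmetric] S_fun_times_Psi_m_ground[of m' x, symmetric] w_def
        by (simp only: scaleR_conv_of_real complex_norm_square complex_cnj_mult mult_ac)
    qed
    finally show "L2_inner (density ?M (\<lambda>x. ennreal (w x))) (S_fun m) (S_fun m') = (if m = m' then 1 else 0)"
      using basis m m' by (simp add: orthonormal_basis_def)
  next
    fix f :: "real ^ 'n::{finite,linorder} \<Rightarrow> complex" and e :: real
    assume f: "f \<in> L2 (density ?M (\<lambda>x. ennreal (w x)))" and e: "0 < e"
    define k where "k x = f x * Psi_m ground x" for x
    have fm: "f \<in> borel_measurable ?M" using f by (simp add: L2_def)
    have Pm: "Psi_m ground \<in> borel_measurable ?M" by (intro measurable_restrict_space1) simp
    have "integrable ?M (\<lambda>x. w x *\<^sub>R (norm (f x))\<^sup>2)"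
      using f w fm by (simp add: L2_def integrable_density)
    then have "k \<in> L2 ?M"
      unfolding sq L2_def k_def using fm Pm by (simp add: borel_measurable_times)
    then obtain G where G: "G \<in> lin_span (Psi_m ` weyl_chamber)" "L2_norm ?M (\<lambda>x. k x - G x) < e"
      using basis e unfolding orthonormal_basis_def by blast
    obtain g where g: "g \<in> lin_span S_set" "\<And>x. G x = g x * Psi_m ground x"
      using span_Psi_m_divide[OF G(1)] by blast
    have "(\<integral>x. (norm (f x - g x))\<^sup>2 \<partial>density ?M (\<lambda>x. ennreal (w x))) = (\<integral>x. w x *\<^sub>R (norm (f x - g x))\<^sup>2 \<partial>?M)"
      using w fm S_meas[OF g(1)] by (intro integral_density) auto
    also have "\<dots> = (\<integral>x. (norm (k x - G x))\<^sup>2 \<partial>?M)"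
      unfolding sq[where g = "\<lambda>x. f x - g x"] by (simp add: k_def g(2) left_diff_distrib)
    finally have "L2_norm (density ?M (\<lambda>x. ennreal (w x))) (\<lambda>x. f x - g x) < e"
      using G(2) by (simp add: L2_norm_def)
    then show "\<exists>g\<in>lin_span (S_fun ` weyl_chamber). L2_norm (density ?M (\<lambda>x. ennreal (w x))) (\<lambda>x. f x - g x) < e"
      using g(1) by (auto simp: S_set_def)
  qed
qed

theorem proposition3p1:
  shows "orthonormal_basis (restrict_space lborel config)
           (weyl_chamber :: (int ^ 'n::{finite,linorder}) set) Psi_m
       \<and> orthonormal_basis (restrict_space mu config)
           (weyl_chamber :: (int ^ 'n::{finite,linorder}) set) S_fun
       \<and> (\<forall>f \<in> (S_set :: (real ^ 'n::{finite,linorder} \<Rightarrow> complex) set). on_cbar f \<and> bounded (range f) \<and> smooth f)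
       \<and> (\<forall>f \<in> (C_cbar :: (real ^ 'n::{finite,linorder} \<Rightarrow> complex) set). \<forall>e>0.
            \<exists>g \<in> lin_span S_set. \<forall>x. norm (f x - g x) < e)"
proof (intro conjI ballI)
  fix f :: "real ^ 'n::{finite,linorder} \<Rightarrow> complex"
  assume "f \<in> S_set"
  then obtain m where f: "f = S_fun m" by (auto simp: S_set_def)
  show "on_cbar f" unfolding f by (intro on_cbar_span_sym_wave S_fun_in_span_sym_wave)
  show "smooth f" unfolding f by (intro smooth_span_wave S_fun_in_span_wave)
  show "bounded (range f)"
    unfolding f bounded_iff using bounded_span_wave[OF S_fun_in_span_wave[of m]] by blast
qed (use orthonormal_basis_Psi_m orthonormal_basis_S_fun span_S_set_uniformly_dense in blast)+

end
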